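(* Let $\lambda\in\mathbf{k}$ be fixed, let $(X,\leq)$ be a well-ordered set and let $\leq_{\rm PL_r}$ be the right path-lexicographical order on the set $\mathfrak{S}(X)$ of nonunitary bracketed words on $X$ (defined in the context). (a) The set $$S_{\rm mrbr}:=\big\{\lfloor x\lfloor y\rfloor\rfloor+\lfloor\lfloor x\rfloor y\rfloor+\lambda xy-\lfloor x\rfloor\lfloor y\rfloor\ \big|\ x,y\in\mathfrak{S}(X)\big\}$$ is a Gröbner-Shirshov basis in $\mathbf{k}\mathfrak{S}(X)$ with respect to $\leq_{\rm PL_r}$. (b) The set $$\mathrm{Irr}(S_{\rm mrbr}):=\mathfrak{S}(X)\setminus\big\{q|_{\lfloor x\lfloor y\rfloor\rfloor}\ \big|\ x,y\in\mathfrak{S}(X),\ q\in\mathfrak{S}^\star(X)\big\}$$ is (via its image in the quotient) a $\mathbf{k}$-basis of the free nonunitary modified Rota-Baxter algebra $\mathbf{k}\mathfrak{S}(X)/\mathrm{Id}(S_{\rm mrbr})$ (of weight $\lambda$) on $X$.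
   Context: $\mathbf{k}$ is a unitary commutative ring of characteristic zero; nonunitary algebras are associative, not necessarily commutative $\mathbf{k}$-algebras, not required to have a unit. A nonunitary modified Rota-Baxter algebra of weight $\lambda$ is a nonunitary algebra $A$ with a linear operator $P:A\to A$ such that $P(x)P(y)=P(P(x)y+xP(y))+\lambda xy$ for all $x,y\in A$. Nonunitary bracketed words. For a set $Y$, let $\mathrm{Sg}(Y)$ be the free semigroup on $Y$ (nonempty words). Put $\mathfrak{S}_0(X)=\mathrm{Sg}(X)$ and $\mathfrak{S}_n(X)=\mathrm{Sg}(X\sqcup\lfloor\mathfrak{S}_{n-1}(X)\rfloor)$ for $n\ge1$, where $\lfloor Y\rfloor=\{\lfloor u\rfloor\mid u\in Y\}$ is a disjoint copy of $Y$; with the natural embeddings, $\mathfrak{S}(X)=\bigcup_{n\ge0}\mathfrak{S}_n(X)$. Each $w\in\mathfrak{S}(X)$ is uniquely $w=w_1\cdots w_k$, $k\ge1$, with $w_i\in X\sqcup\lfloor\mathfrak{S}(X)\rfloor$ (prime elements); $|w|=k$ is the breadth. $\mathbf{k}\mathfrak{S}(X)$ is the free module on $\mathfrak{S}(X)$, a nonunitary algebra with the linear operator extending $w\mapsto\lfloor w\rfloor$. $\mathrm{Id}(S)$ is the operated ideal generated by $S$ (smallest ideal containing $S$ and closed under $\lfloor\ \rfloor$); quotients carry the induced operator. $\star$-bracketed words. For a symbol $\star\notin X$, $\mathfrak{S}^\star(X)$ is the set of elements of $\mathfrak{S}(X\sqcup\{\star\})$ in which $\star$ occurs exactly once; $q|_u$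 replaces $\star$ in $q$ by $u\in\mathfrak{S}(X)$, and $q|_s=\sum_ic_iq|_{u_i}$ for $s=\sum_ic_iu_i\in\mathbf{k}\mathfrak{S}(X)$. Order. $\deg(w)$ is the total number of occurrences in $w$ of letters of $X$. Let $P,\mu$ be two symbols not in $X$, and $M(X\sqcup\{P,\mu\})$ the free monoid. If $x_1,\dots,x_k$ are the occurrences of letters of $X$ in $w$ from left to right, define $\mathrm{Path}_w(x_i)\in M(X\sqcup\{P,\mu\})$ recursively: if $w=x_i\in X$, it is $x_i$; if $w=\lfloor w'\rfloor$, it is $P\,\mathrm{Path}_{w'}(x_i)$; if $w=w_1\cdots w_n$ with $n\ge2$, $w_j$ prime, and the occurrence $x_i$ lies in $w_j$, it is $\mu\,\mathrm{Path}_{w_j}(x_i)$. Put $\mathrm{Path}_{\rm r}(w)=(\mathrm{Path}_w(x_k),\mathrm{Path}_w(x_{k-1}),\dots,\mathrm{Path}_w(x_1))$. Extend the order of $X$ to $X\sqcup\{P,\mu\}$ by $x<P<\mu$ for all $x\in X$ and order $M(X\sqcup\{P,\mu\})$ by the degree lexicographical order (length first, then lexicographically from the left). Define $u\leq_{\rm PL_r}v$ iff $(\deg(u),\mathrm{Path}_{\rm r}(u))\leq(\deg(v),\mathrm{Path}_{\rm r}(v))$ lexicographically, individual paths being compared by the degree lexicographical order. Gröbner-Shirshov bases. With respect to the order, $\overline{s}$ denotes the leading (largest) monomial of $0\ne s\in\mathbf{k}\mathfrak{S}(X)$; $s$ is monic if $\overline{s}$ has coefficient $1$. Let $f,g$ be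 monic. If $w=\overline fu=v\overline g$ with $u,v,w\in\mathfrak{S}(X)$ and $\max\{|\overline f|,|\overline g|\}<|w|<|\overline f|+|\overline g|$, then $fu-vg$ is an intersection composition with respect to $w$. If $w=\overline f=q|_{\overline g}$ with $q\in\mathfrak{S}^\star(X)$, then $f-q|_g$ is an including composition with respect to $w$. An element $h$ is trivial modulo $(S,w)$ if $h=\sum_ic_iq_i|_{s_i}$ with $c_i\in\mathbf{k}$, $q_i\in\mathfrak{S}^\star(X)$, $s_i\in S$ and $\overline{q_i|_{s_i}}<w$. A monic set $S$ is a Gröbner-Shirshov basis if all intersection and including compositions (with respect to $w$) of pairs in $S$ are trivial modulo $(S,w)$. *)

theory Defs
  imports "HOL-Library.Poly_Mapping" "HOL-Algebra.QuotRing" "HOL-Algebra.Module"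
    "HOL-Algebra.Algebraic_Closure_Type"
begin

section \<open>Nonunitary bracketed words\<close>

text \<open>
  The nonunitary bracketed words are the nonempty words in prime elements, where a prime element is
  a letter or a bracketed word enclosed in a bracket. The datatype is the union of the
  stages \<open>\<SS>\<^sub>n\<close> of the usual construction as a direct limit (\<open>n\<close> bounds the bracket depth), and
  the constructors express that each word is uniquely a product of primes.
\<close>

datatype 'x bword = Single "'x prime_word" | Join "'x prime_word" "'x bword"
  and 'x prime_word = Letter 'x | Bracket "'x bword"

abbreviation letter :: "'x \<Rightarrow> 'x bword"
  where "letter x \<equiv> Single (Letter x)"

abbreviation bracket :: "'x bword \<Rightarrow> 'x bword"  (\<open>\<lfloor>\<lfloor>_\<rfloor>\<rfloor>\<close>)
  where "\<lfloor>\<lfloor>w\<rfloor>\<rfloor> \<equiv> Single (Bracket w)"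

primrec concat_word :: "'x bword \<Rightarrow> 'x bword \<Rightarrow> 'x bword"  (infixr \<open>\<cdot>\<close> 75) where
  "Single p \<cdot> v = Join p v"
| "Join p u \<cdot> v = Join p (u \<cdot> v)"

primrec breadth :: "'x bword \<Rightarrow> nat" where
  "breadth (Single p) = 1"
| "breadth (Join p w) = Suc (breadth w)"

text \<open>The occurrences of letters, from left to right.\<close>

primrec letters :: "'x bword \<Rightarrow> 'x list" and letters_prime :: "'x prime_word \<Rightarrow> 'x list" where
  "letters (Single p) = letters_prime p"
| "letters (Join p w) = letters_prime p @ letters w"
| "letters_prime (Letter x) = [x]"
| "letters_prime (Bracket w) = letters w"

definition words :: "'x set \<Rightarrow> 'x bword set"
  where "words \<X> = {w. set (letters w) \<subseteq> \<X>}"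

text \<open>In a \<open>\<star>\<close>-bracketed word, \<^term>\<open>None\<close> plays the role of the symbol \<open>\<star>\<close>.\<close>

definition star_words :: "'x set \<Rightarrow> 'x option bword set"
  where "star_words \<X> = {q \<in> words (insert None (Some ` \<X>)). count_list (letters q) None = 1}"

primrec subst_star :: "'x bword \<Rightarrow> 'x option bword \<Rightarrow> 'x bword"
  and subst_star_prime :: "'x bword \<Rightarrow> 'x option prime_word \<Rightarrow> 'x bword" where
  "subst_star u (Single p) = subst_star_prime u p"
| "subst_star u (Join p q) = subst_star_prime u p \<cdot> subst_star u q"
| "subst_star_prime u (Letter a) = (case a of None \<Rightarrow> u | Some x \<Rightarrow> letter x)"
| "subst_star_prime u (Bracket q) = \<lfloor>\<lfloor>subst_star u q\<rfloor>\<rfloor>"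


section \<open>The right path-lexicographical order\<close>

text \<open>The symbols \<open>\<X> \<squnion> {P, \<mu>}\<close>, ordered by \<open>x < P < \<mu>\<close>; the free monoid on them consists of lists.\<close>

datatype 'x path_symbol = Leaf 'x | PSym | MuSym

fun symbol_less :: "'x::linorder path_symbol \<Rightarrow> 'x path_symbol \<Rightarrow> bool" where
  "symbol_less (Leaf x) (Leaf y) \<longleftrightarrow> x < y"
| "symbol_less (Leaf x) PSym \<longleftrightarrow> True"
| "symbol_less (Leaf x) MuSym \<longleftrightarrow> True"
| "symbol_less PSym MuSym \<longleftrightarrow> True"
| "symbol_less _ _ \<longleftrightarrow> False"

text \<open>
  \<open>paths w\<close> lists the paths of all letter occurrences of \<open>w\<close> from left to right.
  For a word with at least two prime factors, each path inside a factor is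
  prefixed with exactly one \<open>\<mu>\<close>; therefore \<open>factor_paths\<close> first collects the paths inside the
  factors without that prefix.
\<close>

definition mu_prefix :: "'x bword \<Rightarrow> 'x path_symbol list list \<Rightarrow> 'x path_symbol list list"
  where "mu_prefix w ps = (if breadth w \<ge> 2 then map (Cons MuSym) ps else ps)"

primrec factor_paths :: "'x bword \<Rightarrow> 'x path_symbol list list"
  and prime_paths :: "'x prime_word \<Rightarrow> 'x path_symbol list list" where
  "factor_paths (Single p) = prime_paths p"
| "factor_paths (Join p w) = prime_paths p @ factor_paths w"
| "prime_paths (Letter x) = [[Leaf x]]"
| "prime_paths (Bracket w) = map (Cons PSym) (mu_prefix w (factor_paths w))"

definition paths :: "'x bword \<Rightarrow> 'x path_symbol list list"
  where "paths w = mu_prefix w (factor_paths w)"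

definition Path_r :: "'x bword \<Rightarrow> 'x path_symbol list list"
  where "Path_r w = rev (paths w)"

definition word_deg :: "'x bword \<Rightarrow> nat"
  where "word_deg w = length (letters w)"

text \<open>\<^const>\<open>lenlex\<close> is the degree lexicographical order.\<close>

definition PLr_le :: "'x::linorder bword \<Rightarrow> 'x bword \<Rightarrow> bool"
  where "PLr_le u v \<longleftrightarrow> word_deg u < word_deg v \<or> word_deg u = word_deg v \<and>
    (Path_r u = Path_r v \<or>
     (Path_r u, Path_r v) \<in> lex (lenlex {(a, b). symbol_less a b}))"


section \<open>Operated algebras\<close>

text \<open>
  A module record of HOL-Algebra also carries a multiplication. Its field \<^const>\<open>one\<close> is not used
  here: no algebra is required to have a unit.
\<close>

record ('k, 'a) operated = "('k, 'a) module" +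
  oper :: "'a \<Rightarrow> 'a"

locale nonunitary_algebra =
  Module.module ring_of_type_algebra A
  for A :: "('k::comm_ring_1, 'a, 'm) module_scheme" (structure) +
  assumes mult_closed: "\<lbrakk>x \<in> carrier A; y \<in> carrier A\<rbrakk> \<Longrightarrow> x \<otimes> y \<in> carrier A"
    and mult_assoc: "\<lbrakk>x \<in> carrier A; y \<in> carrier A; z \<in> carrier A\<rbrakk> \<Longrightarrow>
      (x \<otimes> y) \<otimes> z = x \<otimes> (y \<otimes> z)"
    and mult_distrib_right: "\<lbrakk>x \<in> carrier A; y \<in> carrier A; z \<in> carrier A\<rbrakk> \<Longrightarrow>
      (x \<oplus> y) \<otimes> z = x \<otimes> z \<oplus> y \<otimes> z"
    and mult_distrib_left: "\<lbrakk>x \<in> carrier A; y \<in> carrier A; z \<in> carrier A\<rbrakk> \<Longrightarrow>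
      z \<otimes> (x \<oplus> y) = z \<otimes> x \<oplus> z \<otimes> y"
    and smult_mult_left: "\<lbrakk>x \<in> carrier A; y \<in> carrier A\<rbrakk> \<Longrightarrow> (c \<odot> x) \<otimes> y = c \<odot> (x \<otimes> y)"
    and smult_mult_right: "\<lbrakk>x \<in> carrier A; y \<in> carrier A\<rbrakk> \<Longrightarrow> x \<otimes> (c \<odot> y) = c \<odot> (x \<otimes> y)"

locale modified_rota_baxter_algebra = nonunitary_algebra A
  for wt :: "'k::comm_ring_1" and A :: "('k, 'a, 'm) operated_scheme" (structure) +
  assumes oper_closed: "x \<in> carrier A \<Longrightarrow> oper A x \<in> carrier A"
    and oper_add: "\<lbrakk>x \<in> carrier A; y \<in> carrier A\<rbrakk> \<Longrightarrow> oper A (x \<oplus> y) = oper A x \<oplus> oper A y"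
    and oper_smult: "x \<in> carrier A \<Longrightarrow> oper A (c \<odot> x) = c \<odot> oper A x"
    and modified_rota_baxter: "\<lbrakk>x \<in> carrier A; y \<in> carrier A\<rbrakk> \<Longrightarrow>
      oper A x \<otimes> oper A y = oper A (oper A x \<otimes> y \<oplus> x \<otimes> oper A y) \<oplus> wt \<odot> (x \<otimes> y)"

definition operated_hom ::
  "('k, 'a, 'm) operated_scheme \<Rightarrow> ('k, 'b, 'n) operated_scheme \<Rightarrow> ('a \<Rightarrow> 'b) set" where
  "operated_hom A B = {F \<in> carrier A \<rightarrow> carrier B.
     (\<forall>x\<in>carrier A. \<forall>y\<in>carrier A. F (x \<oplus>\<^bsub>A\<^esub> y) = F x \<oplus>\<^bsub>B\<^esub> F y \<and> F (x \<otimes>\<^bsub>A\<^esub> y) = F x \<otimes>\<^bsub>B\<^esub> F y) \<and>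
     (\<forall>x\<in>carrier A. (\<forall>c. F (c \<odot>\<^bsub>A\<^esub> x) = c \<odot>\<^bsub>B\<^esub> F x) \<and> F (oper A x) = oper B (F x))}"

text \<open>
  The universal property, for target algebras whose elements form a subset of the type \<open>'b\<close>. Since
  quantification over types is only possible at the outermost level, \<open>'b\<close> is a parameter.
\<close>

definition free_modified_rota_baxter_algebra ::
  "'b itself \<Rightarrow> 'k::comm_ring_1 \<Rightarrow> 'x set \<Rightarrow> ('x \<Rightarrow> 'a) \<Rightarrow> ('k, 'a) operated \<Rightarrow> bool" where
  "free_modified_rota_baxter_algebra T wt \<X> j A \<longleftrightarrow>
     modified_rota_baxter_algebra wt A \<and> j \<in> \<X> \<rightarrow> carrier A \<and>
     (\<forall>(B :: ('k, 'b) operated) \<phi>. modified_rota_baxter_algebra wt B \<and> \<phi> \<in> \<X> \<rightarrow> carrier B \<longrightarrow>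
       (\<exists>F\<in>operated_hom A B. (\<forall>x\<in>\<X>. F (j x) = \<phi> x) \<and>
         (\<forall>G\<in>operated_hom A B. (\<forall>x\<in>\<X>. G (j x) = \<phi> x) \<longrightarrow> (\<forall>a\<in>carrier A. G a = F a))))"

definition operated_ideal :: "('k, 'a, 'm) operated_scheme \<Rightarrow> 'a set \<Rightarrow> bool" where
  "operated_ideal A I \<longleftrightarrow> additive_subgroup I A \<and>
     (\<forall>x\<in>I. (\<forall>c. c \<odot>\<^bsub>A\<^esub> x \<in> I) \<and> (\<forall>a\<in>carrier A. a \<otimes>\<^bsub>A\<^esub> x \<in> I \<and> x \<otimes>\<^bsub>A\<^esub> a \<in> I) \<and> oper A x \<in> I)"

definition operated_Id :: "('k, 'a, 'm) operated_scheme \<Rightarrow> 'a set \<Rightarrow> 'a set"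
  where "operated_Id A S = \<Inter>{I. operated_ideal A I \<and> S \<subseteq> I}"

definition operated_quotient ::
  "('k, 'a, 'm) operated_scheme \<Rightarrow> 'a set \<Rightarrow> ('k, 'a set) operated" where
  "operated_quotient A I =
     \<lparr>carrier = carrier (A Quot I), monoid.mult = monoid.mult (A Quot I), one = one (A Quot I),
      zero = zero (A Quot I), add = add (A Quot I),
      module.smult = (\<lambda>c C. \<Union>a\<in>C. I +>\<^bsub>A\<^esub> (c \<odot>\<^bsub>A\<^esub> a)),
      oper = (\<lambda>C. \<Union>a\<in>C. I +>\<^bsub>A\<^esub> oper A a)\<rparr>"

definition module_basis :: "('k::zero, 'a, 'm) module_scheme \<Rightarrow> 'a set \<Rightarrow> bool" where
  "module_basis A B \<longleftrightarrow> B \<subseteq> carrier A \<and>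
     (\<forall>a\<in>carrier A. \<exists>F c. finite F \<and> F \<subseteq> B \<and> a = (\<Oplus>\<^bsub>A\<^esub>b\<in>F. c b \<odot>\<^bsub>A\<^esub> b)) \<and>
     (\<forall>F c. finite F \<and> F \<subseteq> B \<and> (\<Oplus>\<^bsub>A\<^esub>b\<in>F. c b \<odot>\<^bsub>A\<^esub> b) = \<zero>\<^bsub>A\<^esub> \<longrightarrow> (\<forall>b\<in>F. c b = 0))"


section \<open>The free operated algebra on bracketed words\<close>

type_synonym ('x, 'k) wpoly = "'x bword \<Rightarrow>\<^sub>0 'k"

abbreviation wmono :: "'x bword \<Rightarrow> ('x, 'k::zero_neq_one) wpoly"
  where "wmono w \<equiv> Poly_Mapping.single w 1"

definition scale :: "'k::mult_zero \<Rightarrow> ('x, 'k) wpoly \<Rightarrow> ('x, 'k) wpoly"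
  where "scale c = Poly_Mapping.map ((*) c)"

definition wpoly_mult ::
  "('x, 'k::semiring_0) wpoly \<Rightarrow> ('x, 'k) wpoly \<Rightarrow> ('x, 'k) wpoly"  (infixl \<open>\<bullet>\<close> 70) where
  "f \<bullet> g = (\<Sum>u\<in>Poly_Mapping.keys f. \<Sum>v\<in>Poly_Mapping.keys g.
     Poly_Mapping.single (u \<cdot> v) (Poly_Mapping.lookup f u * Poly_Mapping.lookup g v))"

definition linear_extension ::
  "('x bword \<Rightarrow> 'y bword) \<Rightarrow> ('x, 'k::comm_monoid_add) wpoly \<Rightarrow> ('y, 'k) wpoly" where
  "linear_extension \<phi> f =
     (\<Sum>w\<in>Poly_Mapping.keys f. Poly_Mapping.single (\<phi> w) (Poly_Mapping.lookup f w))"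

definition wpoly_bracket :: "('x, 'k::comm_monoid_add) wpoly \<Rightarrow> ('x, 'k) wpoly"
  where "wpoly_bracket = linear_extension bracket"

definition wpoly_subst_star ::
  "'x option bword \<Rightarrow> ('x, 'k::comm_monoid_add) wpoly \<Rightarrow> ('x, 'k) wpoly"
  where "wpoly_subst_star q = linear_extension (\<lambda>u. subst_star u q)"

definition word_algebra :: "'x set \<Rightarrow> ('k::comm_ring_1, ('x, 'k) wpoly) operated" where
  "word_algebra \<X> =
     \<lparr>carrier = {f. Poly_Mapping.keys f \<subseteq> words \<X>}, monoid.mult = (\<bullet>), one = undefined,
      zero = 0, add = (+), module.smult = scale, oper = wpoly_bracket\<rparr>"


section \<open>Groebner-Shirshov bases\<close>

text \<open>
  Pitfall: \<^const>\<open>PLr_le\<close> is only a total preorder. The words \<open>\<lfloor>xx\<rfloor>\<lfloor>xxx\<rfloor>\<close> and \<open>\<lfloor>xxx\<rfloor>\<lfloor>xx\<rfloor>\<close>, for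
  instance, have the same paths. The strict relation is therefore the strict part of the preorder,
  and a leading monomial has to be strictly larger than every other monomial, so that it
  is unique when it exists. For a linear order it is the largest monomial.
\<close>

definition strict_part :: "('a \<Rightarrow> 'a \<Rightarrow> bool) \<Rightarrow> 'a \<Rightarrow> 'a \<Rightarrow> bool"
  where "strict_part leq u v \<longleftrightarrow> leq u v \<and> \<not> leq v u"

definition leading_monomial ::
  "('x bword \<Rightarrow> 'x bword \<Rightarrow> bool) \<Rightarrow> ('x, 'k::zero) wpoly \<Rightarrow> 'x bword \<Rightarrow> bool" where
  "leading_monomial leq s m \<longleftrightarrow> m \<in> Poly_Mapping.keys s \<and>
     (\<forall>u\<in>Poly_Mapping.keys s. u \<noteq> m \<longrightarrow> strict_part leq u m)"

definition monic_wpoly ::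
  "('x bword \<Rightarrow> 'x bword \<Rightarrow> bool) \<Rightarrow> ('x, 'k::zero_neq_one) wpoly \<Rightarrow> bool" where
  "monic_wpoly leq s \<longleftrightarrow> (\<exists>m. leading_monomial leq s m \<and> Poly_Mapping.lookup s m = 1)"

definition trivial_modulo ::
  "'x set \<Rightarrow> ('x bword \<Rightarrow> 'x bword \<Rightarrow> bool) \<Rightarrow> ('x, 'k::comm_ring_1) wpoly set \<Rightarrow> 'x bword \<Rightarrow>
   ('x, 'k) wpoly \<Rightarrow> bool" where
  "trivial_modulo \<X> leq S w h \<longleftrightarrow>
     (\<exists>ts :: ('k \<times> 'x option bword \<times> ('x, 'k) wpoly) list.
        (\<forall>(c, q, s)\<in>set ts. q \<in> star_words \<X> \<and> s \<in> S \<and>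
           (\<exists>m. leading_monomial leq (wpoly_subst_star q s) m \<and> strict_part leq m w)) \<and>
        h = (\<Sum>(c, q, s)\<leftarrow>ts. scale c (wpoly_subst_star q s)))"

definition groebner_shirshov_basis ::
  "'x set \<Rightarrow> ('x bword \<Rightarrow> 'x bword \<Rightarrow> bool) \<Rightarrow> ('x, 'k::comm_ring_1) wpoly set \<Rightarrow> bool" where
  "groebner_shirshov_basis \<X> leq S \<longleftrightarrow>
     S \<subseteq> carrier (word_algebra \<X>) \<and> (\<forall>s\<in>S. monic_wpoly leq s) \<and>
     (\<forall>f\<in>S. \<forall>g\<in>S. \<forall>f' g'. leading_monomial leq f f' \<and> leading_monomial leq g g' \<longrightarrow>
        (\<forall>u\<in>words \<X>. \<forall>v\<in>words \<X>. \<forall>w\<in>words \<X>.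
           w = f' \<cdot> u \<and> w = v \<cdot> g' \<and>
           max (breadth f') (breadth g') < breadth w \<and> breadth w < breadth f' + breadth g' \<longrightarrow>
           trivial_modulo \<X> leq S w (f \<bullet> wmono u - wmono v \<bullet> g)) \<and>
        (\<forall>q\<in>star_words \<X>. \<forall>w. w = f' \<and> w = subst_star g' q \<longrightarrow>
           trivial_modulo \<X> leq S w (f - wpoly_subst_star q g)))"


section \<open>The relations of modified Rota-Baxter algebras\<close>

definition S_mrbr :: "'x set \<Rightarrow> 'k::comm_ring_1 \<Rightarrow> ('x, 'k) wpoly set" where
  "S_mrbr \<X> wt =
     {wmono \<lfloor>\<lfloor>x \<cdot> \<lfloor>\<lfloor>y\<rfloor>\<rfloor>\<rfloor>\<rfloor> + wmono \<lfloor>\<lfloor>\<lfloor>\<lfloor>x\<rfloor>\<rfloor> \<cdot> y\<rfloor>\<rfloor> + scale wt (wmono (x \<cdot> y)) - wmono (\<lfloor>\<lfloor>x\<rfloor>\<rfloor> \<cdot> \<lfloor>\<lfloor>y\<rfloor>\<rfloor>)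
      | x y. x \<in> words \<X> \<and> y \<in> words \<X>}"

definition Irr_mrbr :: "'x set \<Rightarrow> 'x bword set" where
  "Irr_mrbr \<X> = words \<X> -
     {subst_star \<lfloor>\<lfloor>x \<cdot> \<lfloor>\<lfloor>y\<rfloor>\<rfloor>\<rfloor>\<rfloor> q | x y q. x \<in> words \<X> \<and> y \<in> words \<X> \<and> q \<in> star_words \<X>}"

definition mrb_ideal :: "'x set \<Rightarrow> 'k::comm_ring_1 \<Rightarrow> ('x, 'k) wpoly set"
  where "mrb_ideal \<X> wt = operated_Id (word_algebra \<X>) (S_mrbr \<X> wt)"

definition mrb_quotient :: "'x set \<Rightarrow> 'k::comm_ring_1 \<Rightarrow> ('k, ('x, 'k) wpoly set) operated"
  where "mrb_quotient \<X> wt = operated_quotient (word_algebra \<X>) (mrb_ideal \<X> wt)"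

definition word_class :: "'x set \<Rightarrow> 'k::comm_ring_1 \<Rightarrow> 'x bword \<Rightarrow> ('x, 'k) wpoly set"
  where "word_class \<X> wt w = mrb_ideal \<X> wt +>\<^bsub>word_algebra \<X> :: ('k, ('x, 'k) wpoly) operated\<^esub> wmono w"

end

theory Submission
  imports Defs
begin

text \<open>
  Every relation \<open>R x y = \<lfloor>x\<lfloor>y\<rfloor>\<rfloor> + \<lfloor>\<lfloor>x\<rfloor>y\<rfloor> + \<lambda>xy - \<lfloor>x\<rfloor>\<lfloor>y\<rfloor>\<close> has the leading monomial \<open>\<lfloor>x\<lfloor>y\<rfloor>\<rfloor>\<close>,
  since there the path of the rightmost letter is strictly longest. Leading monomials have breadth
  one, so there are no intersection compositions, and the only overlap that is not resolved by
  bilinearity of \<open>R\<close> comes from \<open>\<lfloor>x\<lfloor>a\<lfloor>b\<rfloor>\<rfloor>\<rfloor>\<close>. It is resolved by an identity that holds for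
  every linear operator on an associative algebra (\<open>mrb_defect_identity\<close>).

  Linear independence does not use the Composition-Diamond lemma. Irreducible words are closed under
  concatenation, so their span is a free algebra on irreducible primes, on which an operator \<open>P\<close> is
  given by \<open>P(w) = \<lfloor>w\<rfloor>\<close> when \<open>\<lfloor>w\<rfloor>\<close> is irreducible and by
  \<open>P(x\<lfloor>y\<rfloor>) = P(x)\<lfloor>y\<rfloor> - \<lambda>xy - P(P(x)y)\<close> otherwise. The same identity shows by induction
  that \<open>P\<close> satisfies the modified Rota-Baxter equation. Evaluating words in this algebra is then a
  normal form map that kills the ideal and fixes the irreducible words.
\<close>

section \<open>Linear operators on the free operated algebra\<close>

text \<open>The formula for \<open>P\<close> is the modified Rota-Baxter equation solved for its
  leading term. If \<lfloor>y\<rfloor> is irreducible then P(y) = \<lfloor>y\<rfloor>, and P(x)P(y)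
  = P(P(x)y) + P(xP(y)) + \<lambda>xy determines P(x\<lfloor>y\<rfloor>). The price is the nested
  value P(P(x)y), whose argument is itself an output of \<open>P\<close>; a bound on the size of
  outputs makes this well-founded. The identity shared by both halves compares the two ways of
  rewriting P(x)P(a)P(b) by the equation: by associativity the cubic terms of D(x,a)P(b) and
  P(x)D(a,b) cancel, where D is the defect of the equation, and what remains is expressed by defects
  again. The usual proof of the Composition-Diamond lemma rests on a linear order compatible with
  all contexts. \<open>PLr_le\<close> is neither antisymmetric nor compatible with contexts, so the
  normal form is constructed directly, by inductions over the size and the structure of
  words.\<close>

lemma lookup_scale [simp]: "Poly_Mapping.lookup (scale c f) w = c * Poly_Mapping.lookup f w"
  by (simp add: scale_def Poly_Mapping.map.rep_eq when_def)

text \<open>This is the type-based module theory, chosen for its \<open>module_hom\<close>; the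
  record-based \<open>Module.module\<close> concerns the quotient and the target algebras.\<close>

global_interpretation wpoly: Modules.module "scale :: 'k::comm_ring_1 \<Rightarrow> ('x, 'k) wpoly \<Rightarrow> ('x, 'k) wpoly"
  by unfold_locales (auto intro!: poly_mapping_eqI simp: lookup_add algebra_simps)

lemma scale_single [simp]: "scale c (Poly_Mapping.single w d) = Poly_Mapping.single w (c * d)"
  by (auto intro!: poly_mapping_eqI simp: lookup_single when_def)

lemma keys_scale: "Poly_Mapping.keys (scale c f) \<subseteq> Poly_Mapping.keys f"
  by (auto simp: in_keys_iff)

lemma wpoly_expand:
  fixes f :: "('x, 'k::comm_ring_1) wpoly"
  assumes "finite A" "Poly_Mapping.keys f \<subseteq> A"
  shows "f = (\<Sum>w\<in>A. scale (Poly_Mapping.lookup f w) (wmono w))"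
proof (rule poly_mapping_eqI)
  fix v
  have "(\<Sum>w\<in>A. Poly_Mapping.lookup f w * (1 when w = v)) =
      (\<Sum>w\<in>A. if w = v then Poly_Mapping.lookup f v else 0)"
    by (rule sum.cong) (auto simp: when_def)
  then show "Poly_Mapping.lookup f v =
      Poly_Mapping.lookup (\<Sum>w\<in>A. scale (Poly_Mapping.lookup f w) (wmono w)) v"
    using assms by (auto simp: lookup_sum lookup_single in_keys_iff when_def sum.delta)
qed

abbreviation linear_op :: "(('x, 'k::comm_ring_1) wpoly \<Rightarrow> ('y, 'k) wpoly) \<Rightarrow> bool"
  where "linear_op T \<equiv> module_hom scale scale T"

lemma linear_opI:
  assumes "\<And>f g. T (f + g) = T f + T g" "\<And>c f. T (scale c f) = scale c (T f)"
  shows "linear_op T"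
  using assms by unfold_locales auto

lemma linear_op_expand:
  assumes "linear_op T"
  shows "T f = (\<Sum>w\<in>Poly_Mapping.keys f. scale (Poly_Mapping.lookup f w) (T (wmono w)))"
proof -
  interpret module_hom scale scale T by fact
  show ?thesis
    by (subst wpoly_expand[of "Poly_Mapping.keys f" f]) (simp_all add: sum scale del: scale_single)
qed

text \<open>Agreement is asked only on the monomials of the given \<open>f\<close>, so that later
  arguments can exploit that these are irreducible.\<close>

lemma linear_op_eqI:
  assumes "linear_op T" "linear_op U"
    and "\<And>w. w \<in> Poly_Mapping.keys f \<Longrightarrow> T (wmono w) = U (wmono w)"
  shows "T f = U f"
  using assms by (simp add: linear_op_expand[of T f] linear_op_expand[of U f])

lemma linear_op_id: "linear_op (\<lambda>f. f)"
  by (rule linear_opI) auto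

lemma linear_op_zero: "linear_op (\<lambda>f. 0)"
  by (rule linear_opI) auto

lemma linear_op_compose: "linear_op T \<Longrightarrow> linear_op U \<Longrightarrow> linear_op (\<lambda>f. T (U f))"
  by (simp add: module_hom_iff)

lemma linear_op_add: "linear_op T \<Longrightarrow> linear_op U \<Longrightarrow> linear_op (\<lambda>f. T f + U f)"
  by (simp add: module_hom_iff algebra_simps)

lemma linear_op_diff: "linear_op T \<Longrightarrow> linear_op U \<Longrightarrow> linear_op (\<lambda>f. T f - U f)"
  by (simp add: module_hom_iff algebra_simps)

lemma linear_op_scale: "linear_op T \<Longrightarrow> linear_op (\<lambda>f. scale c (T f))"
  by (simp add: module_hom_iff algebra_simps)

text \<open>In contrast to \<open>linear_extension\<close>, the values on words are polynomials, as
  they must be for \<open>mrb_op\<close> and \<open>nf\<close>.\<close>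

definition lin :: "('x bword \<Rightarrow> ('y, 'k) wpoly) \<Rightarrow> ('x, 'k::comm_ring_1) wpoly \<Rightarrow> ('y, 'k) wpoly"
  where "lin \<phi> f = (\<Sum>w\<in>Poly_Mapping.keys f. scale (Poly_Mapping.lookup f w) (\<phi> w))"

lemma lin_superset:
  assumes "finite A" "Poly_Mapping.keys f \<subseteq> A"
  shows "lin \<phi> f = (\<Sum>w\<in>A. scale (Poly_Mapping.lookup f w) (\<phi> w))"
  unfolding lin_def using assms by (intro sum.mono_neutral_left) (auto simp: in_keys_iff)

lemma linear_lin:
  fixes \<phi> :: "'x bword \<Rightarrow> ('y, 'k::comm_ring_1) wpoly"
  shows "linear_op (lin \<phi>)"
proof (rule linear_opI)
  fix f g :: "('x, 'k) wpoly"
  have "Poly_Mapping.keys (f + g) \<subseteq> Poly_Mapping.keys f \<union> Poly_Mapping.keys g"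
    by (rule keys_add)
  then show "lin \<phi> (f + g) = lin \<phi> f + lin \<phi> g"
    by (simp add: lin_superset[of "Poly_Mapping.keys f \<union> Poly_Mapping.keys g"] lookup_add
        wpoly.scale_left_distrib sum.distrib)
next
  fix c and f :: "('x, 'k) wpoly"
  show "lin \<phi> (scale c f) = scale c (lin \<phi> f)"
    using keys_scale[of c f]
    by (simp add: lin_superset[of "Poly_Mapping.keys f"] wpoly.scale_sum_right)
qed

lemma lin_wmono [simp]: "lin \<phi> (wmono w) = \<phi> w"
  by (simp add: lin_def)

lemmas lin_add [simp] = module_hom.add[OF linear_lin]
  and lin_scale [simp] = module_hom.scale[OF linear_lin]
  and lin_diff [simp] = module_hom.diff[OF linear_lin]
  and lin_zero [simp] = module_hom.zero[OF linear_lin]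

lemma linear_extension_eq_lin: "linear_extension \<phi> f = lin (\<lambda>w. wmono (\<phi> w)) f"
  by (simp add: linear_extension_def lin_def)

lemma linear_bracket: "linear_op wpoly_bracket"
  and linear_subst_star: "linear_op (wpoly_subst_star q)"
  by (auto simp: wpoly_bracket_def wpoly_subst_star_def linear_extension_eq_lin[abs_def] linear_lin)

lemma wpoly_bracket_wmono [simp]: "wpoly_bracket (wmono w :: ('x, 'k::comm_ring_1) wpoly) = wmono \<lfloor>\<lfloor>w\<rfloor>\<rfloor>"
  and wpoly_subst_star_wmono [simp]:
    "wpoly_subst_star q (wmono w :: ('x, 'k) wpoly) = wmono (subst_star w q)"
  by (simp_all add: wpoly_bracket_def wpoly_subst_star_def linear_extension_eq_lin)

section \<open>The product of polynomials as a bilinear associative operation\<close>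

lemma concat_word_assoc: "(u \<cdot> v) \<cdot> w = u \<cdot> (v \<cdot> w)"
  by (induction u) auto

lemma wpoly_mult_eq_lin:
  fixes f g :: "('x, 'k::comm_ring_1) wpoly"
  shows "f \<bullet> g = lin (\<lambda>u. lin (\<lambda>v. wmono (u \<cdot> v)) g) f"
  by (simp add: wpoly_mult_def lin_def wpoly.scale_sum_right)

lemma wmono_mult_wmono [simp]: "wmono u \<bullet> wmono v = (wmono (u \<cdot> v) :: ('x, 'k::comm_ring_1) wpoly)"
  by (simp add: wpoly_mult_eq_lin)

lemma linear_mult_left: "linear_op (\<lambda>f. f \<bullet> g)"
  by (simp add: wpoly_mult_eq_lin linear_lin)

lemma wpoly_mult_eq_lin_right:
  fixes f g :: "('x, 'k::comm_ring_1) wpoly"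
  shows "f \<bullet> g = lin (\<lambda>v. lin (\<lambda>u. wmono (u \<cdot> v)) f) g"
  by (simp add: wpoly_mult_eq_lin lin_def wpoly.scale_sum_right mult.commute)
     (rule sum.swap)

lemma linear_mult_right: "linear_op (\<lambda>g. f \<bullet> g)"
  by (simp add: wpoly_mult_eq_lin_right linear_lin)

lemmas wpoly_mult_add_left = module_hom.add[OF linear_mult_left]
  and wpoly_mult_diff_left = module_hom.diff[OF linear_mult_left]
  and wpoly_mult_scale_left = module_hom.scale[OF linear_mult_left]
  and wpoly_mult_zero_left [simp] = module_hom.zero[OF linear_mult_left]
  and wpoly_mult_add_right = module_hom.add[OF linear_mult_right]
  and wpoly_mult_diff_right = module_hom.diff[OF linear_mult_right]
  and wpoly_mult_scale_right = module_hom.scale[OF linear_mult_right]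
  and wpoly_mult_zero_right [simp] = module_hom.zero[OF linear_mult_right]

lemmas wpoly_mult_linear = wpoly_mult_add_left wpoly_mult_diff_left wpoly_mult_scale_left
  wpoly_mult_add_right wpoly_mult_diff_right wpoly_mult_scale_right

lemma wpoly_mult_assoc:
  fixes f g h :: "('x, 'k::comm_ring_1) wpoly"
  shows "(f \<bullet> g) \<bullet> h = f \<bullet> (g \<bullet> h)"
proof -
  have 1: "(wmono u \<bullet> wmono v) \<bullet> h = wmono u \<bullet> (wmono v \<bullet> h)" for u v
    by (rule linear_op_eqI[of "\<lambda>h. (wmono u \<bullet> wmono v) \<bullet> h" "\<lambda>h. wmono u \<bullet> (wmono v \<bullet> h)"])
      (simp_all add: linear_mult_right concat_word_assoc
        linear_op_compose[OF linear_mult_right linear_mult_right] del: wmono_mult_wmono,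
       simp add: concat_word_assoc)
  have 2: "(wmono u \<bullet> g) \<bullet> h = wmono u \<bullet> (g \<bullet> h)" for u
    by (rule linear_op_eqI[of "\<lambda>g. (wmono u \<bullet> g) \<bullet> h" "\<lambda>g. wmono u \<bullet> (g \<bullet> h)"])
      (rule linear_op_compose[OF linear_mult_left linear_mult_right]
          linear_op_compose[OF linear_mult_right linear_mult_left] 1)+
  show ?thesis
    by (rule linear_op_eqI[of "\<lambda>f. (f \<bullet> g) \<bullet> h" "\<lambda>f. f \<bullet> (g \<bullet> h)"])
      (rule linear_op_compose[OF linear_mult_left linear_mult_left] linear_mult_left 2)+
qed

text \<open>The operator is a parameter because two are used: with \<open>wpoly_bracket\<close> the
  defects of words are the elements of \<open>S_mrbr\<close>, and with \<open>mrb_lin\<close> the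
  vanishing of the defect is the equation to be proved.\<close>

definition mrb_defect ::
  "(('x, 'k) wpoly \<Rightarrow> ('x, 'k) wpoly) \<Rightarrow> 'k::comm_ring_1 \<Rightarrow> ('x, 'k) wpoly \<Rightarrow> ('x, 'k) wpoly \<Rightarrow> ('x, 'k) wpoly"
  where "mrb_defect P wt f g = P (f \<bullet> P g) + P (P f \<bullet> g) + scale wt (f \<bullet> g) - P f \<bullet> P g"

lemma linear_mrb_defect_left:
  assumes "linear_op P" shows "linear_op (\<lambda>f. mrb_defect P wt f g)"
  unfolding mrb_defect_def
  by (intro linear_op_add linear_op_diff linear_op_scale linear_op_compose[OF assms]
      linear_op_compose[OF linear_mult_left assms] linear_mult_left)

lemma linear_mrb_defect_right:
  assumes "linear_op P" shows "linear_op (\<lambda>g. mrb_defect P wt f g)"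
  unfolding mrb_defect_def
  by (intro linear_op_add linear_op_diff linear_op_scale linear_op_compose[OF assms]
      linear_op_compose[OF linear_mult_right assms] linear_mult_right)

text \<open>
  With \<open>P = \<lfloor> \<rfloor>\<close> this resolves the overlap \<open>\<lfloor>x\<lfloor>a\<lfloor>b\<rfloor>\<rfloor>\<rfloor>\<close>; with \<open>P\<close> the operator on irreducible
  words it is the induction step for the modified Rota-Baxter equation.
\<close>

lemma mrb_defect_identity:
  assumes "linear_op P"
  shows "mrb_defect P wt x (a \<bullet> P b) = P (x \<bullet> mrb_defect P wt a b) + mrb_defect P wt (P x \<bullet> a) b
    - P x \<bullet> mrb_defect P wt a b - mrb_defect P wt x (P a \<bullet> b) + mrb_defect P wt (x \<bullet> P a) b
    + mrb_defect P wt x a \<bullet> P b - P (mrb_defect P wt x a \<bullet> b)"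
proof -
  interpret module_hom scale scale P by fact
  show ?thesis
    unfolding mrb_defect_def
    by (simp add: add diff scale wpoly_mult_linear wpoly_mult_assoc algebra_simps)
qed

section \<open>The operator on irreducible words\<close>

text \<open>Words are built from the left, but whether a bracket is a leading monomial depends on
  the last prime of its content. \<open>None\<close> marks breadth one, since the empty word does
  not exist.\<close>

primrec split_last :: "'x bword \<Rightarrow> 'x bword option \<times> 'x prime_word" where
  "split_last (Single p) = (None, p)"
| "split_last (Join p w) = (case split_last w of
     (None, r) \<Rightarrow> (Some (Single p), r) | (Some u, r) \<Rightarrow> (Some (Join p u), r))"

lemma split_last_snoc [simp]: "split_last (u \<cdot> Single p) = (Some u, p)"
  by (induction u) auto

lemma split_last_eq_None: "split_last w = (None, p) \<longleftrightarrow> w = Single p"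
  by (cases w) (auto split: prod.splits option.splits)

lemma split_last_eq_Some: "split_last w = (Some u, p) \<longleftrightarrow> w = u \<cdot> Single p"
proof
  show "split_last w = (Some u, p) \<Longrightarrow> w = u \<cdot> Single p"
    by (induction w arbitrary: u rule: bword.induct[where ?P2.0 = "\<lambda>_. True"])
      (auto split: prod.splits option.splits simp: split_last_eq_None)
qed auto

lemma concat_word_Single_inject [simp]: "u \<cdot> Single p = v \<cdot> Single r \<longleftrightarrow> u = v \<and> p = r"
  by (metis split_last_snoc option.inject prod.inject)

lemma concat_word_neq_Single [simp]: "u \<cdot> v \<noteq> Single p" "Single p \<noteq> u \<cdot> v"
  by (cases u; simp)+

lemma word_cases_last:
  obtains (Single) p where "w = Single p" | (snoc) u p where "w = u \<cdot> Single p"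
  by (metis option.exhaust prod.exhaust split_last_eq_None split_last_eq_Some)

lemma split_last_concat: "snd (split_last (u \<cdot> v)) = snd (split_last v)"
  by (induction u) (auto split: prod.splits option.splits)

lemma size_concat [simp]: "size (u \<cdot> v) = size u + size (v :: 'x bword)"
  by (induction u) auto

lemma letters_concat [simp]: "letters (u \<cdot> v) = letters u @ letters v"
  by (induction u) auto

text \<open>
  The guard makes the nested recursion terminate; it always holds, by \<open>size_mrb_op\<close>.
\<close>

function (sequential) mrb_op :: "'k::comm_ring_1 \<Rightarrow> 'x bword \<Rightarrow> ('x, 'k) wpoly" where
  "mrb_op wt w = (case split_last w of
     (Some x, Bracket y) \<Rightarrow>
       mrb_op wt x \<bullet> wmono \<lfloor>\<lfloor>y\<rfloor>\<rfloor> - scale wt (wmono (x \<cdot> y)) -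
       (\<Sum>t\<in>Poly_Mapping.keys (mrb_op wt x).
          if size t + size y \<le> size w
          then scale (Poly_Mapping.lookup (mrb_op wt x) t) (mrb_op wt (t \<cdot> y)) else 0)
   | _ \<Rightarrow> wmono \<lfloor>\<lfloor>w\<rfloor>\<rfloor>)"
  by pat_completeness auto
termination
\<comment> \<open>The nested call on \<open>t \<cdot> y\<close> need not decrease the size, as the
  guard only gives \<open>size (t \<cdot> y) \<le> size w\<close>. Its last prime, however, is that
  of \<open>y\<close>, strictly smaller than the last prime \<open>Bracket y\<close> of
  \<open>w\<close>.\<close>
proof (relation "(\<lambda>(wt, w). size w) <*mlex*> measure (\<lambda>(wt, w). size (snd (split_last w)))",
    goal_cases)
  case 1
  show ?case by (intro wf_mlex wf_measure)
next
  case (5 wt w p q x y t)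
  then have "w = x \<cdot> Single (Bracket y)"
    using split_last_eq_Some by metis
  moreover have "size (snd (split_last y)) < size (Bracket y)" for y :: "'b bword"
    by (induction y rule: bword.induct[where ?P2.0 = "\<lambda>_. True"])
      (auto split: prod.splits option.splits)
  ultimately show ?case
    using 5 by (auto simp: mlex_prod_def split_last_concat)
next
  case (2 wt w p q x y)
  then have "w = x \<cdot> Single (Bracket y)"
    using split_last_eq_Some by metis
  then show ?case by (auto simp: mlex_prod_def)
next
  case (3 wt w p q x y)
  then have "w = x \<cdot> Single (Bracket y)"
    using split_last_eq_Some by metis
  then show ?case by (auto simp: mlex_prod_def)
next
  case (4 wt w p q x y t)
  then have "w = x \<cdot> Single (Bracket y)"
    using split_last_eq_Some by metis
  then show ?case by (auto simp: mlex_prod_def)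
qed

declare mrb_op.simps [simp del]

text \<open>The bracket around a plain word is not itself a leading monomial. Every word of breadth
  one is plain, even a bracket, because \<open>x\<close> cannot be empty.\<close>

definition plain :: "'x bword \<Rightarrow> bool"
  where "plain w \<longleftrightarrow> (\<forall>x y. w \<noteq> x \<cdot> \<lfloor>\<lfloor>y\<rfloor>\<rfloor>)"

lemma plain_cases:
  obtains (plain) "plain w" | (snoc) x y where "w = x \<cdot> \<lfloor>\<lfloor>y\<rfloor>\<rfloor>"
  by (auto simp: plain_def)

lemma mrb_op_plain: "plain w \<Longrightarrow> mrb_op wt w = wmono \<lfloor>\<lfloor>w\<rfloor>\<rfloor>"
  by (subst mrb_op.simps, cases w rule: word_cases_last)
    (auto simp: plain_def split: prime_word.splits)

lemma mrb_op_snoc_guarded: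
  "mrb_op wt (x \<cdot> \<lfloor>\<lfloor>y\<rfloor>\<rfloor>) =
     mrb_op wt x \<bullet> wmono \<lfloor>\<lfloor>y\<rfloor>\<rfloor> - scale wt (wmono (x \<cdot> y)) -
       (\<Sum>t\<in>Poly_Mapping.keys (mrb_op wt x).
          if size t \<le> size x + 2
          then scale (Poly_Mapping.lookup (mrb_op wt x) t) (mrb_op wt (t \<cdot> y)) else 0)"
  by (subst mrb_op.simps) (simp add: add.commute)

lemma mrb_op_induct_guarded:
  assumes "\<And>w. plain w \<Longrightarrow> Q w"
    and "\<And>x y. Q x \<Longrightarrow> (\<And>t. t \<in> Poly_Mapping.keys (mrb_op wt x) \<Longrightarrow> size t \<le> size x + 2 \<Longrightarrow> Q (t \<cdot> y))
      \<Longrightarrow> Q (x \<cdot> \<lfloor>\<lfloor>y\<rfloor>\<rfloor>)"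
  shows "Q w"
proof -
  \<comment> \<open>\<open>mrb_op.induct\<close> lets the weight vary; an equation pins it to the
    fixed \<open>wt\<close>.\<close>
  have "wt' = wt \<Longrightarrow> Q w" for wt'
  proof (induction wt' w rule: mrb_op.induct)
    case (1 wt' w)
    show ?case
    proof (cases w rule: plain_cases)
      case (snoc x y)
      then have "(Some x, Bracket y) = split_last w" by simp
      note IH = "1.IH"[OF this refl refl]
      show ?thesis
        unfolding snoc by (rule assms(2)) (use IH snoc "1.prems" in auto)
    qed (rule assms(1))
  qed
  then show ?thesis by simp
qed

lemma keys_wpoly_mult:
  "t \<in> Poly_Mapping.keys (f \<bullet> g) \<Longrightarrow>
    \<exists>u\<in>Poly_Mapping.keys f. \<exists>v\<in>Poly_Mapping.keys g. t = u \<cdot> v"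
  unfolding wpoly_mult_def
  by (drule subsetD[OF keys_sum], clarsimp, drule subsetD[OF keys_sum])
     (auto split: if_splits)

lemma keys_lin: "Poly_Mapping.keys (lin \<phi> f) \<subseteq> (\<Union>w\<in>Poly_Mapping.keys f. Poly_Mapping.keys (\<phi> w))"
  unfolding lin_def using keys_sum keys_scale by fastforce

text \<open>The constant 2 is what a bracket adds to the size, one for \<open>Single\<close> and one
  for \<open>Bracket\<close>. The induction hypothesis is available for exactly the terms passing
  the guard, so the bound is obtained before the guard is known to hold.\<close>

lemma size_mrb_op: "t \<in> Poly_Mapping.keys (mrb_op wt w) \<Longrightarrow> size t \<le> size w + 2"
proof (induction w arbitrary: t rule: mrb_op_induct_guarded[where wt = wt])
  case (1 w)
  then show ?case by (auto simp: mrb_op_plain split: if_splits)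
next
  case (2 x y)
  consider "t \<in> Poly_Mapping.keys (mrb_op wt x \<bullet> wmono \<lfloor>\<lfloor>y\<rfloor>\<rfloor>)" | "t = x \<cdot> y"
    | s where "s \<in> Poly_Mapping.keys (mrb_op wt x)" "size s \<le> size x + 2"
        "t \<in> Poly_Mapping.keys (mrb_op wt (s \<cdot> y))"
    using 2(3) unfolding mrb_op_snoc_guarded
    by (auto dest!: subsetD[OF keys_diff] subsetD[OF keys_sum] subsetD[OF keys_scale]
        split: if_splits)
  then show ?case
  proof cases
    case 1
    then show ?thesis
      using 2(1) by (auto dest!: keys_wpoly_mult split: if_splits)
  next
    case 3
    then show ?thesis using 2(2)[of s t] by simp
  qed auto
qed

text \<open>The size bound makes every guard true, which leaves the intended recursion.\<close>

lemma mrb_op_snoc: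
  "mrb_op wt (x \<cdot> \<lfloor>\<lfloor>y\<rfloor>\<rfloor>) =
     mrb_op wt x \<bullet> wmono \<lfloor>\<lfloor>y\<rfloor>\<rfloor> - scale wt (wmono (x \<cdot> y)) -
       lin (mrb_op wt) (mrb_op wt x \<bullet> wmono y)"
proof -
  have "lin (mrb_op wt) (mrb_op wt x \<bullet> wmono y) =
      (\<Sum>t\<in>Poly_Mapping.keys (mrb_op wt x).
          scale (Poly_Mapping.lookup (mrb_op wt x) t) (mrb_op wt (t \<cdot> y)))"
    by (subst linear_op_expand[OF linear_op_compose[OF linear_lin linear_mult_left]]) simp
  also have "\<dots> = (\<Sum>t\<in>Poly_Mapping.keys (mrb_op wt x). if size t \<le> size x + 2
      then scale (Poly_Mapping.lookup (mrb_op wt x) t) (mrb_op wt (t \<cdot> y)) else 0)"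
    using size_mrb_op by (intro sum.cong) auto
  finally show ?thesis by (simp add: mrb_op_snoc_guarded)
qed

lemma mrb_op_induct [case_names plain snoc]:
  assumes "\<And>w. plain w \<Longrightarrow> Q w"
    and "\<And>x y. Q x \<Longrightarrow> (\<And>t. t \<in> Poly_Mapping.keys (mrb_op wt x) \<Longrightarrow> Q (t \<cdot> y)) \<Longrightarrow> Q (x \<cdot> \<lfloor>\<lfloor>y\<rfloor>\<rfloor>)"
  shows "Q w"
  using assms size_mrb_op by (induction w rule: mrb_op_induct_guarded[where wt = wt]) blast+

text \<open>Structural counterpart of \<open>Irr_mrbr\<close>, suited to recursion over words;
  \<open>Irr_mrbr_eq\<close> identifies the two.\<close>

primrec irr :: "'x bword \<Rightarrow> bool" and irr_prime :: "'x prime_word \<Rightarrow> bool" where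
  "irr (Single p) = irr_prime p"
| "irr (Join p w) = (irr_prime p \<and> irr w)"
| "irr_prime (Letter x) = True"
| "irr_prime (Bracket w) = (irr w \<and> plain w)"

lemma irr_concat [simp]: "irr (u \<cdot> v) \<longleftrightarrow> irr u \<and> irr v"
  by (induction u) auto

text \<open>The operator only creates brackets around plain words, and irreducible words are closed
  under factors and products; hence irreducibility survives. The unchanged letter sequence keeps all
  results over the same alphabet.\<close>

lemma keys_mrb_op:
  "t \<in> Poly_Mapping.keys (mrb_op wt w) \<Longrightarrow> letters t = letters w \<and> (irr w \<longrightarrow> irr t)"
proof (induction w arbitrary: t rule: mrb_op_induct[where wt = wt])
  case (plain w)
  then show ?case by (auto simp: mrb_op_plain split: if_splits)
next
  case (snoc x y)
  consider "t \<in> Poly_Mapping.keys (mrb_op wt x \<bullet> wmono \<lfloor>\<lfloor>y\<rfloor>\<rfloor>)" | "t = x \<cdot> y"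
    | s where "s \<in> Poly_Mapping.keys (mrb_op wt x \<bullet> wmono y)"
        "t \<in> Poly_Mapping.keys (mrb_op wt s)"
    using snoc(3) unfolding mrb_op_snoc
    by (auto dest!: subsetD[OF keys_diff] subsetD[OF keys_lin] split: if_splits)
  then show ?case
  proof cases
    case 1
    then show ?thesis
      using snoc(1) by (auto dest!: keys_wpoly_mult split: if_splits)
  next
    case 3
    then obtain r where "r \<in> Poly_Mapping.keys (mrb_op wt x)" "s = r \<cdot> y"
      by (auto dest!: keys_wpoly_mult split: if_splits)
    then show ?thesis using 3(2) snoc(1)[of r] snoc(2)[of r t] by simp
  qed auto
qed

abbreviation mrb_lin :: "'k::comm_ring_1 \<Rightarrow> ('x, 'k) wpoly \<Rightarrow> ('x, 'k) wpoly"
  where "mrb_lin wt \<equiv> lin (mrb_op wt)"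

text \<open>For plain \<open>y\<close> the operator takes \<open>y\<close> to its bracket, and the
  equation then is the defining recursion at
  \<open>w \<cdot> \<lfloor>\<lfloor>y\<rfloor>\<rfloor>\<close> for each monomial \<open>w\<close>
  of \<open>f\<close>.\<close>

lemma mrb_defect_plain:
  fixes f :: "('x, 'k::comm_ring_1) wpoly"
  assumes "plain y"
  shows "mrb_defect (mrb_lin wt) wt f (wmono y) = 0"
  by (rule linear_op_eqI[OF linear_mrb_defect_left[OF linear_lin] linear_op_zero])
    (simp add: mrb_defect_def mrb_op_plain[OF assms] mrb_op_snoc)

text \<open>Irreducibility of a\<lfloor>b\<rfloor> forces \<open>b\<close> to be plain, so that
  \<lfloor>b\<rfloor> = P(b) and \<open>mrb_defect_identity\<close> applies. On its right side the
  defects at (a, b), (P(f)a, b) and (fP(a), b) vanish because \<open>b\<close> is plain, and the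
  defects at (f, a) by induction. The defect at (f, P(a)b) involves only words
  \<open>r \<cdot> b\<close> with \<open>r\<close> in the support of P(a): these are the nested
  calls of the recursion, hence the choice of induction rule.\<close>

lemma mrb_defect_irr_word:
  fixes f :: "('x, 'k::comm_ring_1) wpoly"
  assumes "irr y"
  shows "mrb_defect (mrb_lin wt) wt f (wmono y) = 0"
  using assms
proof (induction y arbitrary: f rule: mrb_op_induct[where wt = wt])
  case (plain w)
  then show ?case by (simp add: mrb_defect_plain)
next
  case (snoc a b)
  then have b: "plain b" and irr: "irr a" "irr b" by auto
  have "mrb_defect (mrb_lin wt) wt f (mrb_lin wt (wmono a) \<bullet> wmono b) = 0"
  proof (rule linear_op_eqI[OF linear_mrb_defect_right[OF linear_lin] linear_op_zero])
    fix w assume "w \<in> Poly_Mapping.keys (mrb_lin wt (wmono a) \<bullet> (wmono b :: ('x, 'k) wpoly))"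
    then obtain r where r: "r \<in> Poly_Mapping.keys (mrb_op wt a)" "w = r \<cdot> b"
      by (auto dest!: keys_wpoly_mult split: if_splits)
    then show "mrb_defect (mrb_lin wt) wt f (wmono w) = 0"
      using snoc.IH(2)[OF r(1)] keys_mrb_op[OF r(1)] irr by simp
  qed
  moreover have "mrb_lin wt (wmono b) = wmono \<lfloor>\<lfloor>b\<rfloor>\<rfloor>"
    by (simp add: mrb_op_plain[OF b])
  ultimately show ?case
    using mrb_defect_identity[OF linear_lin, of "mrb_op wt" wt f "wmono a" "wmono b"] snoc.IH(1) irr
    by (simp add: mrb_defect_plain[OF b])
qed

lemma mrb_defect_irr:
  assumes "\<And>w. w \<in> Poly_Mapping.keys g \<Longrightarrow> irr w"
  shows "mrb_defect (mrb_lin wt) wt f g = 0"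
  by (rule linear_op_eqI[OF linear_mrb_defect_right[OF linear_lin] linear_op_zero])
    (simp add: mrb_defect_irr_word assms)

section \<open>Normal forms by evaluation\<close>

primrec nf :: "'k::comm_ring_1 \<Rightarrow> 'x bword \<Rightarrow> ('x, 'k) wpoly"
  and nf_prime :: "'k \<Rightarrow> 'x prime_word \<Rightarrow> ('x, 'k) wpoly" where
  "nf wt (Single p) = nf_prime wt p"
| "nf wt (Join p w) = nf_prime wt p \<bullet> nf wt w"
| "nf_prime wt (Letter x) = wmono (letter x)"
| "nf_prime wt (Bracket w) = mrb_lin wt (nf wt w)"

abbreviation normal_form :: "'k::comm_ring_1 \<Rightarrow> ('x, 'k) wpoly \<Rightarrow> ('x, 'k) wpoly"
  where "normal_form wt \<equiv> lin (nf wt)"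

lemma nf_concat: "nf wt (u \<cdot> v) = nf wt u \<bullet> nf wt v"
  by (induction u) (auto simp: wpoly_mult_assoc)

lemma normal_form_mult: "normal_form wt (f \<bullet> g) = normal_form wt f \<bullet> normal_form wt g"
proof -
  have *: "normal_form wt (wmono u \<bullet> g) = normal_form wt (wmono u) \<bullet> normal_form wt g" for u
    by (rule linear_op_eqI[OF linear_op_compose[OF linear_lin linear_mult_right]
          linear_op_compose[OF linear_mult_right linear_lin]])
      (simp add: nf_concat)
  show ?thesis
    by (rule linear_op_eqI[OF linear_op_compose[OF linear_lin linear_mult_left]
          linear_op_compose[OF linear_mult_left linear_lin] *])
qed

lemma normal_form_bracket: "normal_form wt (wpoly_bracket f) = mrb_lin wt (normal_form wt f)"
  by (rule linear_op_eqI[OF linear_op_compose[OF linear_lin linear_bracket]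
        linear_op_compose[OF linear_lin linear_lin]]) simp

lemma nf_irr: "irr w \<Longrightarrow> nf wt w = wmono w"
  by (induction w rule: bword.induct[where ?P2.0 = "\<lambda>p. irr_prime p \<longrightarrow> nf_prime wt p = wmono (Single p)"])
    (auto simp: mrb_op_plain)

lemma keys_nf: "t \<in> Poly_Mapping.keys (nf wt w) \<Longrightarrow> letters t = letters w \<and> irr t"
proof (induction w arbitrary: t rule: bword.induct[where ?P2.0 =
      "\<lambda>p. \<forall>t\<in>Poly_Mapping.keys (nf_prime wt p). letters t = letters_prime p \<and> irr t"])
  case (Bracket w)
  show ?case
  proof
    fix t assume "t \<in> Poly_Mapping.keys (nf_prime wt (Bracket w))"
    then obtain s where "s \<in> Poly_Mapping.keys (nf wt w)" "t \<in> Poly_Mapping.keys (mrb_op wt s)"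
      by (auto dest!: subsetD[OF keys_lin])
    then show "letters t = letters_prime (Bracket w) \<and> irr t"
      using Bracket[of s] keys_mrb_op[of t wt s] by auto
  qed
qed (auto dest!: keys_wpoly_mult split: if_splits)

text \<open>\<open>normal_form\<close> commutes with products and intertwines the two operators, so
  it carries defects to defects; its values have irreducible support, where the defect
  vanishes.\<close>

lemma normal_form_mrb_defect: "normal_form wt (mrb_defect wpoly_bracket wt f g) = 0"
proof -
  have "normal_form wt (mrb_defect wpoly_bracket wt f g) =
      mrb_defect (mrb_lin wt) wt (normal_form wt f) (normal_form wt g)"
    by (simp add: mrb_defect_def normal_form_mult normal_form_bracket)
  also have "\<dots> = 0"
    by (rule mrb_defect_irr) (auto dest!: subsetD[OF keys_lin] keys_nf)
  finally show ?thesis .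
qed

lemma normal_form_irr: "(\<And>w. w \<in> Poly_Mapping.keys f \<Longrightarrow> irr w) \<Longrightarrow> normal_form wt f = f"
  by (rule linear_op_eqI[OF linear_lin linear_op_id]) (simp add: nf_irr)

section \<open>Substitution into star words\<close>

abbreviation lift_word :: "'x bword \<Rightarrow> 'x option bword"
  where "lift_word \<equiv> map_bword Some"

abbreviation star :: "'x option bword"
  where "star \<equiv> letter None"

lemma letters_map_bword [simp]: "letters (map_bword f w) = map f (letters w)"
  by (induction w rule: bword.induct[where ?P2.0 =
        "\<lambda>p. letters_prime (map_prime_word f p) = map f (letters_prime p)"]) auto

lemma subst_star_lift [simp]: "subst_star u (lift_word w) = w"
  by (induction w rule: bword.induct[where ?P2.0 =
        "\<lambda>p. subst_star_prime u (map_prime_word Some p) = Single p"]) auto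

lemma subst_star_concat [simp]: "subst_star u (p \<cdot> q) = subst_star u p \<cdot> subst_star u q"
  by (induction p) (auto simp: concat_word_assoc)

lemma map_bword_concat: "map_bword f (v \<cdot> w) = map_bword f v \<cdot> map_bword f w"
  by (induction v) auto

text \<open>A word without the star is the lift of an ordinary word, so a decomposition found after
  substitution can be transported back.\<close>

lemma lift_subst_star: "None \<notin> set (letters q) \<Longrightarrow> lift_word (subst_star u q) = q"
proof (induction q rule: bword.induct[where ?P2.0 =
        "\<lambda>p. None \<notin> set (letters_prime p) \<longrightarrow> lift_word (subst_star_prime u p) = Single p"])
  case (Join p q)
  then show ?case by (auto simp: map_bword_concat)
qed (auto split: option.splits)

lemma letters_subst_star:
  "letters (subst_star u q) =
    concat (map (\<lambda>a. case a of None \<Rightarrow> letters u | Some x \<Rightarrow> [x]) (letters q))"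
  by (induction q rule: bword.induct[where ?P2.0 = "\<lambda>p. letters (subst_star_prime u p) =
        concat (map (\<lambda>a. case a of None \<Rightarrow> letters u | Some x \<Rightarrow> [x]) (letters_prime p))"])
    (auto split: option.splits)

lemma words_simps [simp]:
  "u \<cdot> v \<in> words \<X> \<longleftrightarrow> u \<in> words \<X> \<and> v \<in> words \<X>"
  "\<lfloor>\<lfloor>u\<rfloor>\<rfloor> \<in> words \<X> \<longleftrightarrow> u \<in> words \<X>"
  "letter x \<in> words \<X> \<longleftrightarrow> x \<in> \<X>"
  by (auto simp: words_def)

lemma count_list_map_Some [simp]: "count_list (map Some xs) None = 0"
  by (induction xs) auto

lemma star_words_intros [simp]:
  "star \<in> star_words \<X>"
  "\<lfloor>\<lfloor>q\<rfloor>\<rfloor> \<in> star_words \<X> \<longleftrightarrow> q \<in> star_words \<X>"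
  "q \<in> star_words \<X> \<Longrightarrow> w \<in> words \<X> \<Longrightarrow> q \<cdot> lift_word w \<in> star_words \<X>"
  "q \<in> star_words \<X> \<Longrightarrow> w \<in> words \<X> \<Longrightarrow> lift_word w \<cdot> q \<in> star_words \<X>"
  by (auto simp: star_words_def words_def)

lemma count_star_words: "q \<in> star_words \<X> \<Longrightarrow> count_list (letters q) None = 1"
  by (simp add: star_words_def)

text \<open>Since the star does occur, all letters of \<open>u\<close> reach the result. The forward
  direction thus recovers membership of an unknown context and of its filling from that of the whole
  word.\<close>

lemma subst_star_in_words_iff:
  assumes "count_list (letters q) None = 1"
  shows "subst_star u q \<in> words \<X> \<longleftrightarrow> u \<in> words \<X> \<and> q \<in> star_words \<X>"
proof -
  have None: "None \<in> set (letters q)"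
    using assms by (metis count_notin zero_neq_one)
  have "set (letters (subst_star u q)) =
      (\<Union>a\<in>set (letters q). case a of None \<Rightarrow> set (letters u) | Some x \<Rightarrow> {x})"
    unfolding letters_subst_star set_concat set_map image_image
    by (rule SUP_cong) (simp_all split: option.split)
  also have "\<dots> = set (letters u) \<union> {x. Some x \<in> set (letters q)}"
    using None by (auto split: option.splits intro: bexI[of _ None] bexI[of _ "Some _"])
  finally have "subst_star u q \<in> words \<X> \<longleftrightarrow>
      u \<in> words \<X> \<and> {x. Some x \<in> set (letters q)} \<subseteq> \<X>"
    by (simp add: words_def)
  moreover have "set (letters q) \<subseteq> insert None (Some ` \<X>) \<longleftrightarrow> {x. Some x \<in> set (letters q)} \<subseteq> \<X>"
    by (auto simp: subset_iff image_iff) (metis option.exhaust)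
  ultimately show ?thesis
    using assms by (simp add: words_def star_words_def)
qed

lemma subst_star_prime_Single: "\<exists>r. subst_star_prime (Single p) s = Single r"
  by (cases s) (auto split: option.splits)

lemma subst_star_eq_Join:
  assumes "subst_star (Single p) q = Join r v"
  obtains s q' where "q = Join s q'" "subst_star_prime (Single p) s = Single r"
    "subst_star (Single p) q' = v"
proof (cases q)
  case (Single s)
  then show thesis using subst_star_prime_Single[of p s] assms by auto
next
  case (Join s q')
  then show thesis using subst_star_prime_Single[of p s] assms that by auto
qed

text \<open>The substituted word is a single prime and cannot straddle the cut between
  \<open>u\<close> and \<open>v\<close>; the star therefore lies wholly on one side, and the other
  side is star-free.\<close>

lemma subst_star_eq_concat:
  assumes "count_list (letters q) None = 1" "subst_star (Single p) q = u \<cdot> v"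
  shows "(\<exists>q'. count_list (letters q') None = 1 \<and> q = q' \<cdot> lift_word v \<and> subst_star (Single p) q' = u) \<or>
    (\<exists>q'. count_list (letters q') None = 1 \<and> q = lift_word u \<cdot> q' \<and> subst_star (Single p) q' = v)"
  using assms
proof (induction u arbitrary: q rule: bword.induct[where ?P2.0 = "\<lambda>_. True"])
  case (Single r)
  then obtain s q2 where q: "q = Join s q2" and s': "subst_star_prime (Single p) s = Single r"
    and eq: "subst_star (Single p) q2 = v"
    using subst_star_eq_Join by (metis concat_word.simps(1))
  show ?case
  proof (cases "None \<in> set (letters_prime s)")
    case True
    then have "count_list (letters_prime s) None = 1" "None \<notin> set (letters q2)"
      using Single.prems(1) count_list_0_iff[of "letters_prime s" None]
        count_list_0_iff[of "letters q2" None] by (auto simp: q simp del: count_list_0_iff)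
    then show ?thesis
      using eq s' lift_subst_star[of q2 "Single p"]
      by (intro disjI1 exI[of _ "Single s"]) (auto simp: q)
  next
    case False
    then have "lift_word (subst_star_prime (Single p) s) = Single s"
      using lift_subst_star[of "Single s" "Single p"] by simp
    then show ?thesis
      using False eq s' Single.prems(1) by (intro disjI2 exI[of _ q2]) (auto simp: q)
  qed
next
  case (Join r u)
  then obtain s q2 where q: "q = Join s q2" and s': "subst_star_prime (Single p) s = Single r"
    and eq: "subst_star (Single p) q2 = u \<cdot> v"
    using subst_star_eq_Join by (metis concat_word.simps(2))
  show ?case
  proof (cases "None \<in> set (letters_prime s)")
    case True
    then have "count_list (letters_prime s) None = 1" and no: "None \<notin> set (letters q2)"
      using Join.prems(1) count_list_0_iff[of "letters_prime s" None]
        count_list_0_iff[of "letters q2" None] by (auto simp: q simp del: count_list_0_iff)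
    moreover have "q2 = lift_word u \<cdot> lift_word v"
      using lift_subst_star[OF no, of "Single p"] eq by (metis map_bword_concat)
    ultimately show ?thesis
      using eq s' by (intro disjI1 exI[of _ "Join s (lift_word u)"]) (auto simp: q)
  next
    case False
    then have *: "lift_word (subst_star_prime (Single p) s) = Single s"
      using lift_subst_star[of "Single s" "Single p"] by simp
    have "count_list (letters q2) None = 1"
      using False Join.prems(1) by (auto simp: q)
    from Join.IH[OF this eq] show ?thesis
    proof (elim disjE exE conjE)
      fix q' assume "count_list (letters q') None = 1"
        "q2 = q' \<cdot> lift_word v" "subst_star (Single p) q' = u"
      then show ?thesis
        using False * eq s' by (intro disjI1 exI[of _ "Join s q'"]) (auto simp: q)
    next
      fix q' assume "count_list (letters q') None = 1"
        "q2 = lift_word u \<cdot> q'" "subst_star (Single p) q' = v"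
      then show ?thesis
        using False * eq s' by (intro disjI2 exI[of _ q']) (auto simp: q)
    qed
  qed
qed auto

text \<open>The four ways of building a context become identity, bracket, right and left
  multiplication. Compositions can then be computed by operator identities instead of on
  words.\<close>

lemma wpoly_subst_star_context [simp]:
  fixes f :: "('x, 'k::comm_ring_1) wpoly"
  shows "wpoly_subst_star star f = f"
    and "wpoly_subst_star \<lfloor>\<lfloor>q\<rfloor>\<rfloor> f = wpoly_bracket (wpoly_subst_star q f)"
    and "wpoly_subst_star (q \<cdot> lift_word w) f = wpoly_subst_star q f \<bullet> wmono w"
    and "wpoly_subst_star (lift_word w \<cdot> q) f = wmono w \<bullet> wpoly_subst_star q f"
  by (rule linear_op_eqI[OF linear_subst_star], rule linear_op_id linear_subst_star
      linear_op_compose[OF linear_bracket linear_subst_star]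
      linear_op_compose[OF linear_mult_left linear_subst_star]
      linear_op_compose[OF linear_mult_right linear_subst_star], simp)+

section \<open>Comparing leading monomials\<close>

text \<open>
  \<^const>\<open>PLr_le\<close> is not compatible with contexts: passing from \<open>\<lfloor>\<lfloor>xy\<rfloor>\<rfloor>\<close> and \<open>x\<lfloor>\<lfloor>y\<rfloor>\<rfloor>\<close> to
  \<open>z\<lfloor>\<lfloor>xy\<rfloor>\<rfloor>\<close> and \<open>zx\<lfloor>\<lfloor>y\<rfloor>\<rfloor>\<close> reverses the order, because only the first word gains a \<open>\<mu>\<close>. The
  relation \<open>dominated\<close> is a part of the strict order that is stable under substitution, since it
  compares the paths both with and without the prefix \<open>\<mu>\<close>.
\<close>

definition last_path_less :: "'x path_symbol list list \<Rightarrow> 'x path_symbol list list \<Rightarrow> bool" where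
  "last_path_less ps qs \<longleftrightarrow> (\<exists>A A' a a' C. ps = A @ a # C \<and> qs = A' @ a' # C \<and>
     length A = length A' \<and> length a < length a')"

definition dominated :: "'x bword \<Rightarrow> 'x bword \<Rightarrow> bool" where
  "dominated u v \<longleftrightarrow>
     last_path_less (factor_paths u) (factor_paths v) \<and> last_path_less (paths u) (paths v)"

lemma last_path_less_map_Cons:
  assumes "last_path_less ps qs" shows "last_path_less (map (Cons s) ps) (map (Cons s) qs)"
proof -
  from assms obtain A A' a a' C where "ps = A @ a # C" "qs = A' @ a' # C"
     "length A = length A'" "length a < length a'"
    unfolding last_path_less_def by blast
  then show ?thesis
    unfolding last_path_less_def
    by (intro exI[of _ "map (Cons s) A"] exI[of _ "map (Cons s) A'"] exI[of _ "s # a"]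
        exI[of _ "s # a'"] exI[of _ "map (Cons s) C"]) auto
qed

lemma last_path_less_append:
  assumes "last_path_less ps qs"
  shows "last_path_less (l @ ps) (l @ qs)" "last_path_less (ps @ l) (qs @ l)"
proof -
  from assms obtain A A' a a' C where "ps = A @ a # C" "qs = A' @ a' # C"
     "length A = length A'" "length a < length a'"
    unfolding last_path_less_def by blast
  note * = this
  show "last_path_less (l @ ps) (l @ qs)"
    unfolding last_path_less_def using *
    by (intro exI[of _ "l @ A"] exI[of _ "l @ A'"] exI[of _ a] exI[of _ a'] exI[of _ C]) simp
  show "last_path_less (ps @ l) (qs @ l)"
    unfolding last_path_less_def using *
    by (intro exI[of _ A] exI[of _ A'] exI[of _ a] exI[of _ a'] exI[of _ "C @ l"]) simp
qed

lemma breadth_concat [simp]: "breadth (u \<cdot> v) = breadth u + breadth v"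
  by (induction u) auto

lemma breadth_pos [simp]: "0 < breadth u"
  by (cases u) auto

lemma breadth_concat_ge: "2 \<le> breadth u + breadth v"
  using breadth_pos[of u] breadth_pos[of v] by linarith

lemma factor_paths_concat [simp]: "factor_paths (u \<cdot> v) = factor_paths u @ factor_paths v"
  by (induction u) auto

lemma paths_concat [simp]: "paths (u \<cdot> v) = map (Cons MuSym) (factor_paths (u \<cdot> v))"
  by (simp add: paths_def mu_prefix_def breadth_concat_ge)

lemma factor_paths_bracket [simp]: "factor_paths \<lfloor>\<lfloor>u\<rfloor>\<rfloor> = map (Cons PSym) (paths u)"
  by (simp add: paths_def)

lemma paths_Single [simp]: "paths (Single p) = factor_paths (Single p)"
  by (simp add: paths_def mu_prefix_def)

text \<open>A bracket exposes the prefixed paths of its content, while a product with a further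
  factor exposes the unprefixed ones. Each context step uses one half of \<open>dominated\<close>
  and restores both halves.\<close>

lemma dominated_bracket: "dominated u v \<Longrightarrow> dominated \<lfloor>\<lfloor>u\<rfloor>\<rfloor> \<lfloor>\<lfloor>v\<rfloor>\<rfloor>"
  by (simp add: dominated_def last_path_less_map_Cons del: factor_paths.simps)

lemma dominated_concat:
  assumes "dominated u v" shows "dominated (u \<cdot> w) (v \<cdot> w)" "dominated (w \<cdot> u) (w \<cdot> v)"
  using assms by (auto simp: dominated_def simp del: map_append
      intro!: last_path_less_append last_path_less_map_Cons)

lemma dominated_subst_star:
  assumes "count_list (letters q) None = 1" "dominated u v"
  shows "dominated (subst_star u q) (subst_star v q)"
  using assms(1)
proof (induction q rule: bword.induct[where ?P2.0 = "\<lambda>p. count_list (letters_prime p) None = 1 \<longrightarrow>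
        dominated (subst_star_prime u p) (subst_star_prime v p)"])
  case (Join p q)
  show ?case
  proof (cases "None \<in> set (letters_prime p)")
    case True
    then have one: "count_list (letters_prime p) None = 1" and no: "None \<notin> set (letters q)"
      using Join.prems(1) count_list_0_iff[of "letters_prime p" None]
        count_list_0_iff[of "letters q" None] by (auto simp del: count_list_0_iff)
    have "subst_star u q = subst_star v q"
      by (metis lift_subst_star[OF no] subst_star_lift)
    with dominated_concat(1)[OF Join.hyps[rule_format, OF one]] show ?thesis by simp
  next
    case False
    then have "lift_word (subst_star_prime v p) = Single p" for v :: "'a bword"
      using lift_subst_star[of "Single p" v] by simp
    then have "subst_star_prime u p = subst_star_prime v p"
      by (metis subst_star_lift)
    moreover have "count_list (letters q) None = 1"
      using False Join.prems by simp
    ultimately show ?thesis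
      using dominated_concat(2)[OF Join.IH] by simp
  qed
qed (auto simp: dominated_bracket assms(2) split: option.splits)

lemma length_factor_paths: "length (factor_paths w) = length (letters w)"
  by (induction w rule: bword.induct[where ?P2.0 =
        "\<lambda>p. length (prime_paths p) = length (letters_prime p)"]) (auto simp: mu_prefix_def)

lemma length_paths: "length (paths w) = word_deg w"
  by (simp add: paths_def mu_prefix_def length_factor_paths word_deg_def)

lemma letters_neq_Nil [simp]: "letters w \<noteq> []"
  by (induction w rule: bword.induct[where ?P2.0 = "\<lambda>p. letters_prime p \<noteq> []"]) auto

lemma factor_paths_neq_Nil [simp]: "factor_paths w \<noteq> []" "paths w \<noteq> []"
  using length_factor_paths[of w] by (auto simp: paths_def mu_prefix_def)

section \<open>Length of the path of the rightmost letter\<close>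

definition last_factor_path_length :: "'x bword \<Rightarrow> nat"
  where "last_factor_path_length w = length (last (factor_paths w))"

definition last_path_length :: "'x bword \<Rightarrow> nat"
  where "last_path_length w = length (last (paths w))"

lemma last_path_length_simps [simp]:
  "last_factor_path_length (u \<cdot> v) = last_factor_path_length v"
  "last_factor_path_length \<lfloor>\<lfloor>v\<rfloor>\<rfloor> = Suc (last_path_length v)"
  "last_path_length (u \<cdot> v) = Suc (last_factor_path_length v)"
  "last_path_length \<lfloor>\<lfloor>v\<rfloor>\<rfloor> = Suc (last_path_length v)"
  by (simp_all add: last_factor_path_length_def last_path_length_def last_map
      del: factor_paths.simps map_append)

lemma last_factor_path_length_le: "last_factor_path_length w \<le> last_path_length w"
    "last_path_length w \<le> Suc (last_factor_path_length w)"
  by (simp_all add: last_factor_path_length_def last_path_length_def paths_def mu_prefix_def last_map)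

text \<open>A difference at the rightmost letter decides at once, with an empty common tail, because
  \<open>Path_r\<close> starts there.\<close>

lemma dominatedI:
  assumes "length (letters u) = length (letters v)"
    and "last_factor_path_length u < last_factor_path_length v"
    and "last_path_length u < last_path_length v"
  shows "dominated u v"
proof -
  have *: "last_path_less ps qs"
    if "ps \<noteq> []" "qs \<noteq> []" "length ps = length qs" "length (last ps) < length (last qs)"
    for ps qs :: "'a path_symbol list list"
    unfolding last_path_less_def
    by (intro exI[of _ "butlast ps"] exI[of _ "butlast qs"] exI[of _ "last ps"]
        exI[of _ "last qs"] exI[of _ "[]"]) (use that in auto)
  show ?thesis
    using assms by (auto simp: dominated_def last_factor_path_length_def last_path_length_def
        length_factor_paths length_paths word_deg_def intro!: *)
qed

lemma asym_symbol_less: "asym {(a, b). symbol_less a (b :: 'x::linorder path_symbol)}"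
proof (rule asymI, clarify)
  fix a b :: "'x path_symbol"
  show "symbol_less a b \<Longrightarrow> symbol_less b a \<Longrightarrow> False"
    by (cases a; cases b) auto
qed

text \<open>Reversal turns the common tail into a common initial segment of \<open>Path_r\<close>,
  and a shorter path is smaller whatever its symbols are. Asymmetry of the lexicographic relation
  excludes the opposite comparison, as the strict part of a preorder requires.\<close>

lemma dominated_strict_part:
  fixes u v :: "'x::linorder bword"
  assumes "dominated u v" shows "strict_part PLr_le u v"
proof -
  let ?r = "lex (lenlex {(a, b). symbol_less a (b :: 'x path_symbol)})"
  from assms obtain A A' a a' C where *: "paths u = A @ a # C" "paths v = A' @ a' # C"
     "length A = length A'" "length a < length a'"
    unfolding dominated_def last_path_less_def by blast
  have "(rev A, rev A') \<in> {(xs, ys). length xs = length ys}" using * by simp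
  then have less: "(Path_r u, Path_r v) \<in> ?r"
    unfolding Path_r_def lex_conv using *
    by (auto simp: lenlex_conv intro!: exI[of _ "rev C"])
  moreover have "asym ?r"
    by (intro asym_lex asym_lenlex asym_symbol_less)
  ultimately have "(Path_r v, Path_r u) \<notin> ?r" "Path_r u \<noteq> Path_r v"
    by (auto dest: asymD)
  moreover have "word_deg u = word_deg v"
    using * by (metis length_paths length_append length_Cons)
  ultimately show ?thesis
    using less by (auto simp: strict_part_def PLr_le_def)
qed

text \<open>Let L be the length of the last path of \<open>y\<close>. On the right it grows by
  bracket, \<mu> and bracket to L + 3, with or without an outer prefix. On the left the two lengths
  are at most L + 2, since removing the prefix never lengthens the last path of
  \<open>y\<close>.\<close>

lemma dominated_relation:
  "dominated \<lfloor>\<lfloor>\<lfloor>\<lfloor>x\<rfloor>\<rfloor> \<cdot> y\<rfloor>\<rfloor> \<lfloor>\<lfloor>x \<cdot> \<lfloor>\<lfloor>y\<rfloor>\<rfloor>\<rfloor>\<rfloor>"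
  "dominated (x \<cdot> y) \<lfloor>\<lfloor>x \<cdot> \<lfloor>\<lfloor>y\<rfloor>\<rfloor>\<rfloor>\<rfloor>"
  "dominated (\<lfloor>\<lfloor>x\<rfloor>\<rfloor> \<cdot> \<lfloor>\<lfloor>y\<rfloor>\<rfloor>) \<lfloor>\<lfloor>x \<cdot> \<lfloor>\<lfloor>y\<rfloor>\<rfloor>\<rfloor>\<rfloor>"
  by (rule dominatedI; use last_factor_path_length_le[of y] in \<open>simp del: concat_word.simps\<close>)+

section \<open>The Groebner-Shirshov basis\<close>

abbreviation mrb_rel :: "'k::comm_ring_1 \<Rightarrow> ('x, 'k) wpoly \<Rightarrow> ('x, 'k) wpoly \<Rightarrow> ('x, 'k) wpoly"
  where "mrb_rel \<equiv> mrb_defect wpoly_bracket"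

lemma mrb_rel_wmono:
  "mrb_rel wt (wmono x) (wmono y) = wmono \<lfloor>\<lfloor>x \<cdot> \<lfloor>\<lfloor>y\<rfloor>\<rfloor>\<rfloor>\<rfloor> + wmono \<lfloor>\<lfloor>\<lfloor>\<lfloor>x\<rfloor>\<rfloor> \<cdot> y\<rfloor>\<rfloor> +
     scale wt (wmono (x \<cdot> y)) - wmono (\<lfloor>\<lfloor>x\<rfloor>\<rfloor> \<cdot> \<lfloor>\<lfloor>y\<rfloor>\<rfloor>)"
  by (simp add: mrb_defect_def del: concat_word.simps)

lemma S_mrbr_eq: "S_mrbr \<X> wt = {mrb_rel wt (wmono x) (wmono y) | x y. x \<in> words \<X> \<and> y \<in> words \<X>}"
  unfolding S_mrbr_def mrb_rel_wmono ..

lemma subst_star_mrb_rel: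
  "wpoly_subst_star q (mrb_rel wt (wmono x) (wmono y)) =
     wmono (subst_star \<lfloor>\<lfloor>x \<cdot> \<lfloor>\<lfloor>y\<rfloor>\<rfloor>\<rfloor>\<rfloor> q) + wmono (subst_star \<lfloor>\<lfloor>\<lfloor>\<lfloor>x\<rfloor>\<rfloor> \<cdot> y\<rfloor>\<rfloor> q) +
     scale wt (wmono (subst_star (x \<cdot> y) q)) - wmono (subst_star (\<lfloor>\<lfloor>x\<rfloor>\<rfloor> \<cdot> \<lfloor>\<lfloor>y\<rfloor>\<rfloor>) q)"
  unfolding mrb_rel_wmono
  by (simp only: module_hom.add[OF linear_subst_star] module_hom.diff[OF linear_subst_star]
      module_hom.scale[OF linear_subst_star] wpoly_subst_star_wmono)

text \<open>An arbitrary context is allowed because \<open>trivial_modulo\<close> asks for the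
  leading monomials of substituted relations; the context \<open>star\<close> gives the relation
  itself.\<close>

lemma leading_mrb_rel:
  fixes x y :: "'x::linorder bword" and wt :: "'k::comm_ring_1"
  assumes "count_list (letters q) None = 1"
  shows "leading_monomial PLr_le (wpoly_subst_star q (mrb_rel wt (wmono x) (wmono y)))
      (subst_star \<lfloor>\<lfloor>x \<cdot> \<lfloor>\<lfloor>y\<rfloor>\<rfloor>\<rfloor>\<rfloor> q)" (is "leading_monomial _ ?s ?m")
    and "Poly_Mapping.lookup (wpoly_subst_star q (mrb_rel wt (wmono x) (wmono y)))
      (subst_star \<lfloor>\<lfloor>x \<cdot> \<lfloor>\<lfloor>y\<rfloor>\<rfloor>\<rfloor>\<rfloor> q) = 1"
proof -
  have less: "strict_part PLr_le (subst_star u q) ?m"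
    if "u \<in> {\<lfloor>\<lfloor>\<lfloor>\<lfloor>x\<rfloor>\<rfloor> \<cdot> y\<rfloor>\<rfloor>, x \<cdot> y, \<lfloor>\<lfloor>x\<rfloor>\<rfloor> \<cdot> \<lfloor>\<lfloor>y\<rfloor>\<rfloor>}" for u
    using that dominated_relation by (auto intro!: dominated_strict_part dominated_subst_star[OF assms]
        simp del: concat_word.simps)
  have "subst_star u q \<noteq> ?m" if "u \<in> {\<lfloor>\<lfloor>\<lfloor>\<lfloor>x\<rfloor>\<rfloor> \<cdot> y\<rfloor>\<rfloor>, x \<cdot> y, \<lfloor>\<lfloor>x\<rfloor>\<rfloor> \<cdot> \<lfloor>\<lfloor>y\<rfloor>\<rfloor>}" for u
    using less[OF that] by (auto simp: strict_part_def)
  then show one: "Poly_Mapping.lookup ?s ?m = 1"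
    by (simp add: subst_star_mrb_rel lookup_add lookup_minus lookup_single del: concat_word.simps)
  have "strict_part PLr_le u ?m" if "u \<in> Poly_Mapping.keys ?s" "u \<noteq> ?m" for u
  proof -
    have "u \<in> (\<lambda>u. subst_star u q) ` {\<lfloor>\<lfloor>\<lfloor>\<lfloor>x\<rfloor>\<rfloor> \<cdot> y\<rfloor>\<rfloor>, x \<cdot> y, \<lfloor>\<lfloor>x\<rfloor>\<rfloor> \<cdot> \<lfloor>\<lfloor>y\<rfloor>\<rfloor>}"
      using that by (auto simp: in_keys_iff subst_star_mrb_rel lookup_add lookup_minus lookup_single
          when_def simp del: concat_word.simps split: if_splits)
    then show ?thesis using less by blast
  qed
  then show "leading_monomial PLr_le ?s ?m"
    using one by (auto simp: leading_monomial_def in_keys_iff)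
qed

section \<open>Triviality modulo the relations\<close>

lemma leading_monomial_unique:
  "leading_monomial leq s m \<Longrightarrow> leading_monomial leq s m' \<Longrightarrow> m = m'"
  unfolding leading_monomial_def strict_part_def by metis

lemma trivial_modulo_add:
  assumes "trivial_modulo \<X> leq S w f" "trivial_modulo \<X> leq S w g"
  shows "trivial_modulo \<X> leq S w (f + g)"
proof -
  let ?P = "\<lambda>ts. \<forall>(c, q, s)\<in>set ts. q \<in> star_words \<X> \<and> s \<in> S \<and>
           (\<exists>m. leading_monomial leq (wpoly_subst_star q s) m \<and> strict_part leq m w)"
  obtain ts us where "?P ts" "?P us"
    "f = (\<Sum>(c, q, s)\<leftarrow>ts. scale c (wpoly_subst_star q s))"
    "g = (\<Sum>(c, q, s)\<leftarrow>us. scale c (wpoly_subst_star q s))"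
    using assms unfolding trivial_modulo_def by blast
  then show ?thesis
    unfolding trivial_modulo_def by (intro exI[of _ "ts @ us"]) (auto simp: ball_Un)
qed

lemma trivial_modulo_scale:
  assumes "trivial_modulo \<X> leq S w f"
  shows "trivial_modulo \<X> leq S w (scale a f)"
proof -
  let ?P = "\<lambda>ts. \<forall>(c, q, s)\<in>set ts. q \<in> star_words \<X> \<and> s \<in> S \<and>
           (\<exists>m. leading_monomial leq (wpoly_subst_star q s) m \<and> strict_part leq m w)"
  obtain ts where ts: "?P ts" "f = (\<Sum>(c, q, s)\<leftarrow>ts. scale c (wpoly_subst_star q s))"
    using assms unfolding trivial_modulo_def by blast
  have "scale a (\<Sum>(c, q, s)\<leftarrow>ts. scale c (wpoly_subst_star q s)) =
      (\<Sum>(c, q, s)\<leftarrow>map (\<lambda>(c, q, s). (a * c, q, s)) ts. scale c (wpoly_subst_star q s))" for ts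
    by (induction ts) (auto simp: wpoly.scale_right_distrib)
  then show ?thesis
    unfolding trivial_modulo_def using ts
    by (intro exI[of _ "map (\<lambda>(c, q, s). (a * c, q, s)) ts"]) fastforce
qed

lemma trivial_modulo_zero: "trivial_modulo \<X> leq S w 0"
  unfolding trivial_modulo_def by (intro exI[of _ "[]"]) simp

lemma trivial_modulo_diff:
  assumes "trivial_modulo \<X> leq S w f" "trivial_modulo \<X> leq S w g"
  shows "trivial_modulo \<X> leq S w (f - g)"
  using trivial_modulo_add[OF assms(1) trivial_modulo_scale[OF assms(2), of "- 1"]] by simp

text \<open>The bound is demanded in the form \<open>dominated\<close>, the comparison that can be
  carried through contexts.\<close>

lemma trivial_modulo_mrb_rel:
  fixes \<X> :: "'x::linorder set" and wt :: "'k::comm_ring_1"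
  assumes "q \<in> star_words \<X>" "x \<in> words \<X>" "y \<in> words \<X>"
    and "dominated (subst_star \<lfloor>\<lfloor>x \<cdot> \<lfloor>\<lfloor>y\<rfloor>\<rfloor>\<rfloor>\<rfloor> q) w"
  shows "trivial_modulo \<X> PLr_le (S_mrbr \<X> wt) w (wpoly_subst_star q (mrb_rel wt (wmono x) (wmono y)))"
  unfolding trivial_modulo_def
  using assms leading_mrb_rel(1)[OF count_star_words[OF assms(1)], of wt x y]
  by (intro exI[of _ "[(1, q, mrb_rel wt (wmono x) (wmono y))]"])
    (auto simp: S_mrbr_eq dominated_strict_part simp del: concat_word.simps)

lemma mrb_rel_add_left: "mrb_rel wt (f + g) h = mrb_rel wt f h + mrb_rel wt g h"
  and mrb_rel_diff_left: "mrb_rel wt (f - g) h = mrb_rel wt f h - mrb_rel wt g h"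
  and mrb_rel_scale_left: "mrb_rel wt (scale c f) h = scale c (mrb_rel wt f h)"
  and mrb_rel_add_right: "mrb_rel wt h (f + g) = mrb_rel wt h f + mrb_rel wt h g"
  and mrb_rel_diff_right: "mrb_rel wt h (f - g) = mrb_rel wt h f - mrb_rel wt h g"
  and mrb_rel_scale_right: "mrb_rel wt h (scale c f) = scale c (mrb_rel wt h f)"
  by (rule module_hom.add module_hom.diff module_hom.scale,
      rule linear_mrb_defect_left linear_mrb_defect_right, rule linear_bracket)+

text \<open>Let R be the relation, g = R(a, b) and G = p|_g, with leading monomial \<open>x\<close>.
  Bilinearity gives R(x, y) = R(G, y) - R(G - x, y). The subtracted substitution is the first term
  of R(G, y); its other three terms are contexts applied to g, and R(G - x, y) is a combination of
  relations with a smaller first argument.\<close>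

lemma including_composition_left:
  fixes \<X> :: "'x::linorder set" and wt :: "'k::comm_ring_1"
  assumes p: "p \<in> star_words \<X>" and words: "a \<in> words \<X>" "b \<in> words \<X>" "y \<in> words \<X>"
    and x: "x = subst_star \<lfloor>\<lfloor>a \<cdot> \<lfloor>\<lfloor>b\<rfloor>\<rfloor>\<rfloor>\<rfloor> p"
  shows "trivial_modulo \<X> PLr_le (S_mrbr \<X> wt) \<lfloor>\<lfloor>x \<cdot> \<lfloor>\<lfloor>y\<rfloor>\<rfloor>\<rfloor>\<rfloor>
     (mrb_rel wt (wmono x) (wmono y) -
      wpoly_subst_star \<lfloor>\<lfloor>p \<cdot> lift_word \<lfloor>\<lfloor>y\<rfloor>\<rfloor>\<rfloor>\<rfloor> (mrb_rel wt (wmono a) (wmono b)))"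
    (is "?T (_ - wpoly_subst_star ?q ?g)")
proof -
  define r where "r u = subst_star u p" for u
  let ?G = "wpoly_subst_star p ?g"
  have G: "?G = wmono x + wmono (r \<lfloor>\<lfloor>\<lfloor>\<lfloor>a\<rfloor>\<rfloor> \<cdot> b\<rfloor>\<rfloor>) + scale wt (wmono (r (a \<cdot> b))) -
      wmono (r (\<lfloor>\<lfloor>a\<rfloor>\<rfloor> \<cdot> \<lfloor>\<lfloor>b\<rfloor>\<rfloor>))"
    unfolding r_def x by (rule subst_star_mrb_rel)
  have rel: "?T (mrb_rel wt (wmono (r u)) (wmono y))"
    if "u \<in> {\<lfloor>\<lfloor>\<lfloor>\<lfloor>a\<rfloor>\<rfloor> \<cdot> b\<rfloor>\<rfloor>, a \<cdot> b, \<lfloor>\<lfloor>a\<rfloor>\<rfloor> \<cdot> \<lfloor>\<lfloor>b\<rfloor>\<rfloor>}" for u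
  proof -
    have "dominated u \<lfloor>\<lfloor>a \<cdot> \<lfloor>\<lfloor>b\<rfloor>\<rfloor>\<rfloor>\<rfloor>" "u \<in> words \<X>"
      using that dominated_relation words by (auto simp del: concat_word.simps)
    moreover from this have "r u \<in> words \<X>"
      using p by (simp add: r_def subst_star_in_words_iff count_star_words)
    ultimately show ?thesis
      using trivial_modulo_mrb_rel[of star \<X> "r u" y "\<lfloor>\<lfloor>x \<cdot> \<lfloor>\<lfloor>y\<rfloor>\<rfloor>\<rfloor>\<rfloor>" wt] words(3)
      by (simp add: r_def x dominated_bracket dominated_concat(1) dominated_subst_star
          count_star_words[OF p] del: concat_word.simps)
  qed
  \<comment> \<open>In these three contexts the leading words are
    \<lfloor>\<lfloor>x\<rfloor>y\<rfloor>, xy and \<lfloor>x\<rfloor>\<lfloor>y\<rfloor>, which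
    \<open>dominated_relation\<close> places below \<lfloor>x\<lfloor>y\<rfloor>\<rfloor>.\<close>
  have 1: "?T (wpoly_bracket (wpoly_bracket ?G \<bullet> wmono y))"
    using trivial_modulo_mrb_rel[of "\<lfloor>\<lfloor>\<lfloor>\<lfloor>p\<rfloor>\<rfloor> \<cdot> lift_word y\<rfloor>\<rfloor>" \<X> a b "\<lfloor>\<lfloor>x \<cdot> \<lfloor>\<lfloor>y\<rfloor>\<rfloor>\<rfloor>\<rfloor>" wt]
      dominated_relation(1)[of x y] p words
    by (simp add: x del: concat_word.simps)
  have 2: "?T (?G \<bullet> wmono y)"
    using trivial_modulo_mrb_rel[of "p \<cdot> lift_word y" \<X> a b "\<lfloor>\<lfloor>x \<cdot> \<lfloor>\<lfloor>y\<rfloor>\<rfloor>\<rfloor>\<rfloor>" wt]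
      dominated_relation(2)[of x y] p words
    by (simp add: x del: concat_word.simps)
  have 3: "?T (wpoly_bracket ?G \<bullet> wmono \<lfloor>\<lfloor>y\<rfloor>\<rfloor>)"
    using trivial_modulo_mrb_rel[of "\<lfloor>\<lfloor>p\<rfloor>\<rfloor> \<cdot> lift_word \<lfloor>\<lfloor>y\<rfloor>\<rfloor>" \<X> a b "\<lfloor>\<lfloor>x \<cdot> \<lfloor>\<lfloor>y\<rfloor>\<rfloor>\<rfloor>\<rfloor>" wt]
      dominated_relation(3)[of x y] p words
    by (simp add: x del: concat_word.simps bword.map prime_word.map)
  have "mrb_rel wt (wmono x) (wmono y) - wpoly_subst_star ?q ?g =
      wpoly_bracket (wpoly_bracket ?G \<bullet> wmono y) + scale wt (?G \<bullet> wmono y)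
      - wpoly_bracket ?G \<bullet> wmono \<lfloor>\<lfloor>y\<rfloor>\<rfloor>
      - mrb_rel wt (?G - wmono x) (wmono y)"
    unfolding mrb_rel_diff_left
    by (simp add: mrb_defect_def[of _ _ ?G] del: concat_word.simps bword.map prime_word.map)
  also have "?T \<dots>"
    unfolding G[THEN arg_cong[where f = "\<lambda>f. f - wmono x"]]
    using rel by (auto intro!: trivial_modulo_add trivial_modulo_diff trivial_modulo_scale 1 2 3
        simp: mrb_rel_add_left mrb_rel_diff_left mrb_rel_scale_left
        simp del: concat_word.simps scale_single)
  finally show ?thesis .
qed

text \<open>The mirror image of the previous argument, now with R(x, y) = R(x, G) - R(x, G -
  y).\<close>

lemma including_composition_right:
  fixes \<X> :: "'x::linorder set" and wt :: "'k::comm_ring_1"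
  assumes p: "p \<in> star_words \<X>" and words: "a \<in> words \<X>" "b \<in> words \<X>" "x \<in> words \<X>"
    and y: "y = subst_star \<lfloor>\<lfloor>a \<cdot> \<lfloor>\<lfloor>b\<rfloor>\<rfloor>\<rfloor>\<rfloor> p"
  shows "trivial_modulo \<X> PLr_le (S_mrbr \<X> wt) \<lfloor>\<lfloor>x \<cdot> \<lfloor>\<lfloor>y\<rfloor>\<rfloor>\<rfloor>\<rfloor>
     (mrb_rel wt (wmono x) (wmono y) -
      wpoly_subst_star \<lfloor>\<lfloor>lift_word x \<cdot> \<lfloor>\<lfloor>p\<rfloor>\<rfloor>\<rfloor>\<rfloor> (mrb_rel wt (wmono a) (wmono b)))"
    (is "?T (_ - wpoly_subst_star ?q ?g)")
proof -
  define r where "r u = subst_star u p" for u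
  let ?G = "wpoly_subst_star p ?g"
  have G: "?G = wmono y + wmono (r \<lfloor>\<lfloor>\<lfloor>\<lfloor>a\<rfloor>\<rfloor> \<cdot> b\<rfloor>\<rfloor>) + scale wt (wmono (r (a \<cdot> b))) -
      wmono (r (\<lfloor>\<lfloor>a\<rfloor>\<rfloor> \<cdot> \<lfloor>\<lfloor>b\<rfloor>\<rfloor>))"
    unfolding r_def y by (rule subst_star_mrb_rel)
  have rel: "?T (mrb_rel wt (wmono x) (wmono (r u)))"
    if "u \<in> {\<lfloor>\<lfloor>\<lfloor>\<lfloor>a\<rfloor>\<rfloor> \<cdot> b\<rfloor>\<rfloor>, a \<cdot> b, \<lfloor>\<lfloor>a\<rfloor>\<rfloor> \<cdot> \<lfloor>\<lfloor>b\<rfloor>\<rfloor>}" for u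
  proof -
    have "dominated u \<lfloor>\<lfloor>a \<cdot> \<lfloor>\<lfloor>b\<rfloor>\<rfloor>\<rfloor>\<rfloor>" "u \<in> words \<X>"
      using that dominated_relation words by (auto simp del: concat_word.simps)
    moreover from this have "r u \<in> words \<X>"
      using p by (simp add: r_def subst_star_in_words_iff count_star_words)
    ultimately show ?thesis
      using trivial_modulo_mrb_rel[of star \<X> x "r u" "\<lfloor>\<lfloor>x \<cdot> \<lfloor>\<lfloor>y\<rfloor>\<rfloor>\<rfloor>\<rfloor>" wt] words(3)
      by (simp add: r_def y dominated_bracket dominated_concat(2) dominated_subst_star
          count_star_words[OF p] del: concat_word.simps)
  qed
  have 1: "?T (wpoly_bracket (wmono \<lfloor>\<lfloor>x\<rfloor>\<rfloor> \<bullet> ?G))"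
    using trivial_modulo_mrb_rel[of "\<lfloor>\<lfloor>lift_word \<lfloor>\<lfloor>x\<rfloor>\<rfloor> \<cdot> p\<rfloor>\<rfloor>" \<X> a b "\<lfloor>\<lfloor>x \<cdot> \<lfloor>\<lfloor>y\<rfloor>\<rfloor>\<rfloor>\<rfloor>" wt]
      dominated_relation(1)[of x y] p words
    by (simp add: y del: concat_word.simps bword.map prime_word.map)
  have 2: "?T (wmono x \<bullet> ?G)"
    using trivial_modulo_mrb_rel[of "lift_word x \<cdot> p" \<X> a b "\<lfloor>\<lfloor>x \<cdot> \<lfloor>\<lfloor>y\<rfloor>\<rfloor>\<rfloor>\<rfloor>" wt]
      dominated_relation(2)[of x y] p words
    by (simp add: y del: concat_word.simps)
  have 3: "?T (wmono \<lfloor>\<lfloor>x\<rfloor>\<rfloor> \<bullet> wpoly_bracket ?G)"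
    using trivial_modulo_mrb_rel[of "lift_word \<lfloor>\<lfloor>x\<rfloor>\<rfloor> \<cdot> \<lfloor>\<lfloor>p\<rfloor>\<rfloor>" \<X> a b "\<lfloor>\<lfloor>x \<cdot> \<lfloor>\<lfloor>y\<rfloor>\<rfloor>\<rfloor>\<rfloor>" wt]
      dominated_relation(3)[of x y] p words
    by (simp add: y del: concat_word.simps bword.map prime_word.map)
  have "mrb_rel wt (wmono x) (wmono y) - wpoly_subst_star ?q ?g =
      wpoly_bracket (wmono \<lfloor>\<lfloor>x\<rfloor>\<rfloor> \<bullet> ?G) + scale wt (wmono x \<bullet> ?G)
      - wmono \<lfloor>\<lfloor>x\<rfloor>\<rfloor> \<bullet> wpoly_bracket ?G
      - mrb_rel wt (wmono x) (?G - wmono y)"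
    unfolding mrb_rel_diff_right
    by (simp add: mrb_defect_def[of _ _ _ ?G] del: concat_word.simps)
  also have "?T \<dots>"
    unfolding G[THEN arg_cong[where f = "\<lambda>f. f - wmono y"]]
    using rel by (auto intro!: trivial_modulo_add trivial_modulo_diff trivial_modulo_scale 1 2 3
        simp: mrb_rel_add_right mrb_rel_diff_right mrb_rel_scale_right
        simp del: concat_word.simps scale_single)
  finally show ?thesis .
qed

text \<open>Here the inner leading monomial uses the bracket around \<open>y\<close> itself, so
  bilinearity in \<open>y\<close> does not help. In \<open>mrb_defect_identity\<close> the first
  term on the right is the subtracted substitution; the other six are contexts applied to relations.
  With L the length of the last path of \<open>b\<close>, their leading words have last paths of
  length at most L + 4, against L + 5 for the word of the composition.\<close>

lemma including_composition_overlap: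
  fixes \<X> :: "'x::linorder set" and wt :: "'k::comm_ring_1"
  assumes words: "a \<in> words \<X>" "b \<in> words \<X>" "x \<in> words \<X>"
  shows "trivial_modulo \<X> PLr_le (S_mrbr \<X> wt) \<lfloor>\<lfloor>x \<cdot> \<lfloor>\<lfloor>a \<cdot> \<lfloor>\<lfloor>b\<rfloor>\<rfloor>\<rfloor>\<rfloor>\<rfloor>\<rfloor>
     (mrb_rel wt (wmono x) (wmono (a \<cdot> \<lfloor>\<lfloor>b\<rfloor>\<rfloor>)) -
      wpoly_subst_star \<lfloor>\<lfloor>lift_word x \<cdot> star\<rfloor>\<rfloor> (mrb_rel wt (wmono a) (wmono b)))"
    (is "?T (_ - wpoly_subst_star ?q ?g)")
proof -
  have eq: "mrb_rel wt (wmono x) (wmono (a \<cdot> \<lfloor>\<lfloor>b\<rfloor>\<rfloor>)) - wpoly_subst_star ?q ?g =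
     wpoly_subst_star star (mrb_rel wt (wmono (\<lfloor>\<lfloor>x\<rfloor>\<rfloor> \<cdot> a)) (wmono b))
     - wpoly_subst_star (lift_word \<lfloor>\<lfloor>x\<rfloor>\<rfloor> \<cdot> star) ?g
     - wpoly_subst_star star (mrb_rel wt (wmono x) (wmono (\<lfloor>\<lfloor>a\<rfloor>\<rfloor> \<cdot> b)))
     + wpoly_subst_star star (mrb_rel wt (wmono (x \<cdot> \<lfloor>\<lfloor>a\<rfloor>\<rfloor>)) (wmono b))
     + wpoly_subst_star (star \<cdot> lift_word \<lfloor>\<lfloor>b\<rfloor>\<rfloor>) (mrb_rel wt (wmono x) (wmono a))
     - wpoly_subst_star \<lfloor>\<lfloor>star \<cdot> lift_word b\<rfloor>\<rfloor> (mrb_rel wt (wmono x) (wmono a))"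
    using mrb_defect_identity[OF linear_bracket, of wt "wmono x" "wmono a" "wmono b"]
    unfolding wpoly_subst_star_context wpoly_bracket_wmono wmono_mult_wmono by simp
  note le = last_factor_path_length_le[of b]
  show ?thesis
    unfolding eq
    by (intro trivial_modulo_add trivial_modulo_diff trivial_modulo_mrb_rel dominatedI;
      use words le in \<open>simp del: concat_word.simps bword.map prime_word.map\<close>)
qed

theorem groebner_shirshov_basis_S_mrbr:
  fixes \<X> :: "'x::linorder set" and wt :: "'k::comm_ring_1"
  shows "groebner_shirshov_basis \<X> PLr_le (S_mrbr \<X> wt)"
proof -
  let ?L = "\<lambda>x y :: 'x bword. \<lfloor>\<lfloor>x \<cdot> \<lfloor>\<lfloor>y\<rfloor>\<rfloor>\<rfloor>\<rfloor>" and ?R = "\<lambda>x y. mrb_rel wt (wmono x) (wmono y)"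
  have lead: "leading_monomial PLr_le (?R x y) (?L x y)"
    and one: "Poly_Mapping.lookup (?R x y) (?L x y) = 1" for x y
    using leading_mrb_rel[of star wt x y] by (simp_all del: concat_word.simps)
  have lead_eq: "m = ?L x y" if "leading_monomial PLr_le (?R x y) m" for m x y
    using leading_monomial_unique[OF that lead] .
  have incl: "trivial_modulo \<X> PLr_le (S_mrbr \<X> wt) (?L x y) (?R x y - wpoly_subst_star q (?R a b))"
    if words: "x \<in> words \<X>" "y \<in> words \<X>" "a \<in> words \<X>" "b \<in> words \<X>"
      and q: "q \<in> star_words \<X>" and eq: "?L x y = subst_star (?L a b) q" for x y a b q
  proof -
    note one = count_star_words[OF q]
    \<comment> \<open>The result is one bracket, so \<open>q\<close> is a single prime; it contains
      the star, hence is the star or a bracket. The same argument is repeated below for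
      \<open>p\<close>.\<close>
    consider "q = star" | q1 where "q = \<lfloor>\<lfloor>q1\<rfloor>\<rfloor>" "subst_star (?L a b) q1 = x \<cdot> \<lfloor>\<lfloor>y\<rfloor>\<rfloor>"
    proof (cases q)
      case (Single s)
      then show thesis
        using that one eq by (cases s) (auto split: option.splits)
    next
      case (Join s q')
      then show thesis
        using eq subst_star_prime_Single[of "Bracket (a \<cdot> \<lfloor>\<lfloor>b\<rfloor>\<rfloor>)" s] by auto
    qed
    then show ?thesis
    proof cases
      case 1
      then show ?thesis
        using eq by (simp add: trivial_modulo_zero del: concat_word.simps)
    next
      case (2 q1)
      then have q1: "q1 \<in> star_words \<X>" using q by simp
      consider p where "count_list (letters p) None = 1" "q1 = p \<cdot> lift_word \<lfloor>\<lfloor>y\<rfloor>\<rfloor>"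
            "subst_star (?L a b) p = x"
        | p where "count_list (letters p) None = 1" "q1 = lift_word x \<cdot> p" "subst_star (?L a b) p = \<lfloor>\<lfloor>y\<rfloor>\<rfloor>"
        using subst_star_eq_concat[OF count_star_words[OF q1] 2(2)] by blast
      then show ?thesis
      proof cases
        case (1 p)
        then have "p \<in> star_words \<X>"
          using words subst_star_in_words_iff by blast
        then show ?thesis
          using including_composition_left[of p \<X> a b y x wt] words 1 2 by simp
      next
        case (2 p)
        then have p: "p \<in> star_words \<X>"
          using words subst_star_in_words_iff[of p "?L a b" \<X>] by simp
        consider "p = star" | p1 where "p = \<lfloor>\<lfloor>p1\<rfloor>\<rfloor>" "subst_star (?L a b) p1 = y"
        proof (cases p)
          case (Single s)
          then show thesis
            using that 2 by (cases s) (auto split: option.splits)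
        next
          case (Join s q')
          then show thesis
            using 2 subst_star_prime_Single[of "Bracket (a \<cdot> \<lfloor>\<lfloor>b\<rfloor>\<rfloor>)" s] by auto
        qed
        then show ?thesis
        proof cases
          case 1
          then have "y = a \<cdot> \<lfloor>\<lfloor>b\<rfloor>\<rfloor>" using 2 by simp
          then show ?thesis
            using including_composition_overlap[of a \<X> b x wt] words 1 2 \<open>q = \<lfloor>\<lfloor>q1\<rfloor>\<rfloor>\<close> by simp
        next
          case (2 p1)
          then show ?thesis
            using including_composition_right[of p1 \<X> a b x y wt] words p \<open>q = \<lfloor>\<lfloor>q1\<rfloor>\<rfloor>\<close>
              \<open>q1 = lift_word x \<cdot> p\<close> by simp
        qed
      qed
    qed
  qed
  have keys_ok: "Poly_Mapping.keys (?R x y) \<subseteq> words \<X>" if "x \<in> words \<X>" "y \<in> words \<X>" for x y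
    using that by (auto simp: mrb_rel_wmono in_keys_iff lookup_add lookup_minus lookup_single when_def
        simp del: concat_word.simps split: if_splits)
  show ?thesis
    unfolding groebner_shirshov_basis_def
  proof (intro conjI ballI allI impI)
    show "S_mrbr \<X> wt \<subseteq> carrier (word_algebra \<X>)"
      using keys_ok by (auto simp: S_mrbr_eq word_algebra_def)
  next
    fix s assume "s \<in> S_mrbr \<X> wt"
    then obtain x y where "s = ?R x y" by (auto simp: S_mrbr_eq)
    then show "monic_wpoly PLr_le s"
      unfolding monic_wpoly_def using lead[of x y] one[of x y] by blast
  next
    fix f g f' g' u v w
    assume "f \<in> S_mrbr \<X> wt" "g \<in> S_mrbr \<X> wt"
      "leading_monomial PLr_le f f' \<and> leading_monomial PLr_le g g'"
      "w = f' \<cdot> u \<and> w = v \<cdot> g' \<and>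
           max (breadth f') (breadth g') < breadth w \<and> breadth w < breadth f' + breadth g'"
    then show "trivial_modulo \<X> PLr_le (S_mrbr \<X> wt) w (f \<bullet> wmono u - wmono v \<bullet> g)"
      by (auto simp: S_mrbr_eq gr_implies_not0[OF breadth_pos] dest!: lead_eq)
  next
    fix f g f' g' q w
    assume "f \<in> S_mrbr \<X> wt" "g \<in> S_mrbr \<X> wt"
      "leading_monomial PLr_le f f' \<and> leading_monomial PLr_le g g'"
      "q \<in> star_words \<X>" "w = f' \<and> w = subst_star g' q"
    moreover from this obtain x y a b where "f = ?R x y" "g = ?R a b"
      "x \<in> words \<X>" "y \<in> words \<X>" "a \<in> words \<X>" "b \<in> words \<X>"
      unfolding S_mrbr_eq by blast
    moreover from calculation have "f' = ?L x y" "g' = ?L a b"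
      using lead_eq by blast+
    moreover from calculation
    have "trivial_modulo \<X> PLr_le (S_mrbr \<X> wt) (?L x y) (?R x y - wpoly_subst_star q (?R a b))"
      by (intro incl) auto
    ultimately show "trivial_modulo \<X> PLr_le (S_mrbr \<X> wt) w (f - wpoly_subst_star q g)"
      by simp
  qed
qed

section \<open>Irreducible words\<close>

lemma not_irr_subst_star:
  assumes "count_list (letters q) None = 1" "\<not> irr u"
  shows "\<not> irr (subst_star u q)"
  using assms(1)
proof (induction q rule: bword.induct[where ?P2.0 =
      "\<lambda>p. count_list (letters_prime p) None = 1 \<longrightarrow> \<not> irr (subst_star_prime u p)"])
  case (Join p q)
  then show ?case by (cases "count_list (letters_prime p) None") auto
qed (auto simp: assms(2) split: option.splits)

lemma not_irr_obtain:
  assumes "\<not> irr w"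
  shows "\<exists>q x y. count_list (letters q) None = 1 \<and> w = subst_star \<lfloor>\<lfloor>x \<cdot> \<lfloor>\<lfloor>y\<rfloor>\<rfloor>\<rfloor>\<rfloor> q"
  using assms
proof (induction w rule: bword.induct[where ?P2.0 = "\<lambda>p. \<not> irr_prime p \<longrightarrow>
      (\<exists>q x y. count_list (letters q) None = 1 \<and> Single p = subst_star \<lfloor>\<lfloor>x \<cdot> \<lfloor>\<lfloor>y\<rfloor>\<rfloor>\<rfloor>\<rfloor> q)"])
  case (Join p w)
  show ?case
  proof (cases "irr_prime p")
    case True
    then obtain q x y where q: "count_list (letters q) None = 1" "w = subst_star \<lfloor>\<lfloor>x \<cdot> \<lfloor>\<lfloor>y\<rfloor>\<rfloor>\<rfloor>\<rfloor> q"
      using Join by auto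
    have "Join p w = subst_star \<lfloor>\<lfloor>x \<cdot> \<lfloor>\<lfloor>y\<rfloor>\<rfloor>\<rfloor>\<rfloor> (lift_word (Single p) \<cdot> q)"
      unfolding subst_star_concat subst_star_lift q(2)[symmetric] by simp
    moreover have "count_list (letters (lift_word (Single p) \<cdot> q)) None = 1"
      unfolding letters_concat letters_map_bword count_list_append by (simp add: q(1))
    ultimately show ?thesis by blast
  next
    case False
    then obtain q x y where q: "count_list (letters q) None = 1" "Single p = subst_star \<lfloor>\<lfloor>x \<cdot> \<lfloor>\<lfloor>y\<rfloor>\<rfloor>\<rfloor>\<rfloor> q"
      using Join by auto
    have "Join p w = subst_star \<lfloor>\<lfloor>x \<cdot> \<lfloor>\<lfloor>y\<rfloor>\<rfloor>\<rfloor>\<rfloor> (q \<cdot> lift_word w)"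
      unfolding subst_star_concat subst_star_lift q(2)[symmetric] by simp
    moreover have "count_list (letters (q \<cdot> lift_word w)) None = 1"
      by (simp add: q(1))
    ultimately show ?thesis by blast
  qed
next
  case (Bracket w)
  show ?case
  proof
    assume *: "\<not> irr_prime (Bracket w)"
    show "\<exists>q x y. count_list (letters q) None = 1 \<and> \<lfloor>\<lfloor>w\<rfloor>\<rfloor> = subst_star \<lfloor>\<lfloor>x \<cdot> \<lfloor>\<lfloor>y\<rfloor>\<rfloor>\<rfloor>\<rfloor> q"
    proof (cases "irr w")
      case True
      with * obtain x y where "w = x \<cdot> \<lfloor>\<lfloor>y\<rfloor>\<rfloor>" by (auto simp: plain_def)
      then show ?thesis by (intro exI[of _ star] exI[of _ x] exI[of _ y]) simp
    next
      case False
      then obtain q x y where "count_list (letters q) None = 1" "w = subst_star \<lfloor>\<lfloor>x \<cdot> \<lfloor>\<lfloor>y\<rfloor>\<rfloor>\<rfloor>\<rfloor> q"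
        using Bracket by blast
      then show ?thesis by (intro exI[of _ "\<lfloor>\<lfloor>q\<rfloor>\<rfloor>"] exI[of _ x] exI[of _ y]) simp
    qed
  qed
qed auto

text \<open>An innermost failure of \<open>irr\<close> is a bracket around a word that is not plain;
  the surrounding word supplies the context \<open>q\<close>, whose letters come from \<X> because
  those of \<open>w\<close> do.\<close>

lemma Irr_mrbr_eq: "Irr_mrbr \<X> = {w \<in> words \<X>. irr w}"
proof -
  have "\<not> irr w" if "w = subst_star \<lfloor>\<lfloor>x \<cdot> \<lfloor>\<lfloor>y\<rfloor>\<rfloor>\<rfloor>\<rfloor> q" "q \<in> star_words \<X>" for w x y q
    using that not_irr_subst_star[OF count_star_words, of q \<X> "\<lfloor>\<lfloor>x \<cdot> \<lfloor>\<lfloor>y\<rfloor>\<rfloor>\<rfloor>\<rfloor>"]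
    by (auto simp: plain_def)
  moreover have "\<exists>x y q. w = subst_star \<lfloor>\<lfloor>x \<cdot> \<lfloor>\<lfloor>y\<rfloor>\<rfloor>\<rfloor>\<rfloor> q \<and> x \<in> words \<X> \<and> y \<in> words \<X> \<and> q \<in> star_words \<X>"
    if w: "w \<in> words \<X>" and "\<not> irr w" for w
  proof -
    obtain q x y where q: "count_list (letters q) None = 1" "w = subst_star \<lfloor>\<lfloor>x \<cdot> \<lfloor>\<lfloor>y\<rfloor>\<rfloor>\<rfloor>\<rfloor> q"
      using not_irr_obtain \<open>\<not> irr w\<close> by blast
    then show ?thesis
      using w subst_star_in_words_iff[OF q(1), of "\<lfloor>\<lfloor>x \<cdot> \<lfloor>\<lfloor>y\<rfloor>\<rfloor>\<rfloor>\<rfloor>" \<X>] by auto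
  qed
  ultimately show ?thesis unfolding Irr_mrbr_def by blast
qed

section \<open>The ideal of relations\<close>

definition wpolys :: "'x set \<Rightarrow> ('x, 'k::zero) wpoly set"
  where "wpolys \<X> = {f. Poly_Mapping.keys f \<subseteq> words \<X>}"

lemma word_algebra_simps [simp]:
  fixes \<X> :: "'x set"
  shows "carrier (word_algebra \<X> :: ('k::comm_ring_1, ('x, 'k) wpoly) operated) = wpolys \<X>"
    "f \<otimes>\<^bsub>word_algebra \<X>\<^esub> g = f \<bullet> g" "f \<oplus>\<^bsub>word_algebra \<X>\<^esub> g = f + g"
    "\<zero>\<^bsub>word_algebra \<X> :: ('k, ('x, 'k) wpoly) operated\<^esub> = 0"
    "c \<odot>\<^bsub>word_algebra \<X>\<^esub> f = scale c f"
    "oper (word_algebra \<X>) f = wpoly_bracket f"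
  by (simp_all add: word_algebra_def wpolys_def)

lemma wpolys_add: "f \<in> wpolys \<X> \<Longrightarrow> g \<in> wpolys \<X> \<Longrightarrow> f + g \<in> wpolys \<X>"
  using keys_add[of f g] by (auto simp: wpolys_def)

lemma wpolys_scale: "f \<in> wpolys \<X> \<Longrightarrow> scale c f \<in> wpolys \<X>"
  using keys_scale[of c f] by (auto simp: wpolys_def)

lemma wpolys_diff: "f \<in> wpolys \<X> \<Longrightarrow> g \<in> wpolys \<X> \<Longrightarrow> f - g \<in> wpolys \<X>"
  using keys_diff[of f g] by (auto simp: wpolys_def)

lemma wpolys_mult: "f \<in> wpolys \<X> \<Longrightarrow> g \<in> wpolys \<X> \<Longrightarrow> f \<bullet> g \<in> wpolys \<X>"
  by (fastforce simp: wpolys_def dest: keys_wpoly_mult)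

lemma wpolys_zero: "0 \<in> wpolys \<X>"
  by (simp add: wpolys_def)

lemma wpolys_wmono: "w \<in> words \<X> \<Longrightarrow> wmono w \<in> wpolys \<X>"
  by (simp add: wpolys_def)

lemma wpolys_bracket:
  fixes f :: "('x, 'k::comm_ring_1) wpoly"
  assumes "f \<in> wpolys \<X>" shows "wpoly_bracket f \<in> wpolys \<X>"
proof -
  have "w \<in> words \<X>" if "w \<in> Poly_Mapping.keys (wpoly_bracket f)" for w
    using that subsetD[OF keys_lin, of w "\<lambda>w. wmono \<lfloor>\<lfloor>w\<rfloor>\<rfloor> :: ('x, 'k) wpoly" f] assms
    by (auto simp: wpolys_def wpoly_bracket_def linear_extension_eq_lin)
  then show ?thesis by (auto simp: wpolys_def)
qed

lemmas wpolys_intros = wpolys_add wpolys_diff wpolys_scale wpolys_mult wpolys_zero wpolys_wmono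
  wpolys_bracket

lemma wpolys_induct [consumes 1, case_names zero monomial]:
  fixes f :: "('x, 'k::comm_ring_1) wpoly"
  assumes "f \<in> wpolys \<X>" "Q 0"
    and "\<And>c w g. w \<in> words \<X> \<Longrightarrow> g \<in> wpolys \<X> \<Longrightarrow> Q g \<Longrightarrow> Q (scale c (wmono w) + g)"
  shows "Q f"
proof -
  have "sum h B \<in> wpolys \<X> \<and> Q (sum h B)"
    if "finite B" "B \<subseteq> words \<X>" "h = (\<lambda>w. scale (Poly_Mapping.lookup f w) (wmono w))" for B h
    using that
    by (induction B rule: finite_induct)
      (auto intro!: assms(2,3) wpolys_intros simp del: scale_single)
  then show ?thesis
    using wpoly_expand[of "Poly_Mapping.keys f" f] assms(1)
    by (metis (lifting) finite_keys mem_Collect_eq order_refl wpolys_def)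
qed

lemma abelian_group_word_algebra: "abelian_group (word_algebra \<X>)"
proof (rule abelian_groupI)
  fix f assume "f \<in> carrier (word_algebra \<X>)"
  then show "\<exists>g\<in>carrier (word_algebra \<X>). g \<oplus>\<^bsub>word_algebra \<X>\<^esub> f = \<zero>\<^bsub>word_algebra \<X>\<^esub>"
    using wpolys_scale[of f \<X> "- 1"] by (intro bexI[of _ "- f"]) auto
qed (auto simp: algebra_simps intro: wpolys_intros)

text \<open>Additive inverses are multiples by -1, so closure under scalars takes care of the group
  inverse in \<open>additive_subgroup\<close>.\<close>

lemma operated_ideal_word_algebra_iff:
  fixes I :: "('x, 'k::comm_ring_1) wpoly set"
  shows "operated_ideal (word_algebra \<X>) I \<longleftrightarrow> I \<subseteq> wpolys \<X> \<and> 0 \<in> I \<and> (\<forall>f\<in>I. \<forall>g\<in>I. f + g \<in> I) \<and>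
    (\<forall>f\<in>I. (\<forall>c. scale c f \<in> I) \<and> (\<forall>g\<in>wpolys \<X>. g \<bullet> f \<in> I \<and> f \<bullet> g \<in> I) \<and> wpoly_bracket f \<in> I)"
proof -
  let ?A = "word_algebra \<X> :: ('k, ('x, 'k) wpoly) operated"
  interpret abelian_group ?A by (rule abelian_group_word_algebra)
  have neg: "inv\<^bsub>add_monoid ?A\<^esub> f = scale (- 1) f" if "f \<in> wpolys \<X>" for f
  proof -
    have "\<ominus>\<^bsub>?A\<^esub> f = scale (- 1) f"
      using that wpolys_scale[OF that, of "- 1"] by (intro minus_equality) auto
    then show ?thesis unfolding a_inv_def .
  qed
  have "additive_subgroup I ?A \<longleftrightarrow> I \<subseteq> wpolys \<X> \<and> 0 \<in> I \<and> (\<forall>f\<in>I. \<forall>g\<in>I. f + g \<in> I)"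
    if "\<forall>f\<in>I. \<forall>c. scale c f \<in> I"
  proof
    assume "additive_subgroup I ?A"
    then interpret additive_subgroup I ?A .
    show "I \<subseteq> wpolys \<X> \<and> 0 \<in> I \<and> (\<forall>f\<in>I. \<forall>g\<in>I. f + g \<in> I)"
      using a_subset zero_closed a_closed by auto
  next
    assume "I \<subseteq> wpolys \<X> \<and> 0 \<in> I \<and> (\<forall>f\<in>I. \<forall>g\<in>I. f + g \<in> I)"
    then show "additive_subgroup I ?A"
      using that neg
      by (intro additive_subgroup.intro subgroup.intro)
        (auto simp: subset_iff simp del: wpoly.scale_minus_left)
  qed
  then show ?thesis unfolding operated_ideal_def by auto
qed

lemma operated_ideal_wpolys: "operated_ideal (word_algebra \<X>) (wpolys \<X>)"
  unfolding operated_ideal_word_algebra_iff by (auto intro: wpolys_intros)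

lemma mrb_rel_in_wpolys: "x \<in> words \<X> \<Longrightarrow> y \<in> words \<X> \<Longrightarrow> mrb_rel wt (wmono x) (wmono y) \<in> wpolys \<X>"
  unfolding mrb_defect_def by (intro wpolys_intros)

lemma operated_ideal_mrb_ideal: "operated_ideal (word_algebra \<X>) (mrb_ideal \<X> wt)"
proof -
  \<comment> \<open>The whole carrier is one of the ideals in the intersection, which confines the
    result to it.\<close>
  have "mrb_ideal \<X> wt \<subseteq> wpolys \<X>"
    unfolding mrb_ideal_def operated_Id_def
    using operated_ideal_wpolys[of \<X>] mrb_rel_in_wpolys[of _ \<X>]
    by (intro Inter_lower) (auto simp: S_mrbr_eq)
  then show ?thesis
    unfolding operated_ideal_word_algebra_iff
    by (auto simp: mrb_ideal_def operated_Id_def operated_ideal_word_algebra_iff)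
qed

lemma mrb_ideal_minimal:
  "operated_ideal (word_algebra \<X>) J \<Longrightarrow> S_mrbr \<X> wt \<subseteq> J \<Longrightarrow> mrb_ideal \<X> wt \<subseteq> J"
  unfolding mrb_ideal_def operated_Id_def by blast

lemma mrb_rel_in_mrb_ideal:
  "x \<in> words \<X> \<Longrightarrow> y \<in> words \<X> \<Longrightarrow> mrb_rel wt (wmono x) (wmono y) \<in> mrb_ideal \<X> wt"
  by (auto simp: mrb_ideal_def operated_Id_def S_mrbr_eq)

lemma
  shows mrb_ideal_subset: "f \<in> mrb_ideal \<X> wt \<Longrightarrow> f \<in> wpolys \<X>"
    and mrb_ideal_zero: "0 \<in> mrb_ideal \<X> wt"
    and mrb_ideal_add: "f \<in> mrb_ideal \<X> wt \<Longrightarrow> g \<in> mrb_ideal \<X> wt \<Longrightarrow> f + g \<in> mrb_ideal \<X> wt"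
    and mrb_ideal_scale: "f \<in> mrb_ideal \<X> wt \<Longrightarrow> scale c f \<in> mrb_ideal \<X> wt"
    and mrb_ideal_mult_left: "f \<in> mrb_ideal \<X> wt \<Longrightarrow> h \<in> wpolys \<X> \<Longrightarrow> h \<bullet> f \<in> mrb_ideal \<X> wt"
    and mrb_ideal_mult_right: "f \<in> mrb_ideal \<X> wt \<Longrightarrow> h \<in> wpolys \<X> \<Longrightarrow> f \<bullet> h \<in> mrb_ideal \<X> wt"
    and mrb_ideal_bracket: "f \<in> mrb_ideal \<X> wt \<Longrightarrow> wpoly_bracket f \<in> mrb_ideal \<X> wt"
  using operated_ideal_mrb_ideal[of \<X> wt] unfolding operated_ideal_word_algebra_iff by auto

lemma mrb_ideal_diff:
  "f \<in> mrb_ideal \<X> wt \<Longrightarrow> g \<in> mrb_ideal \<X> wt \<Longrightarrow> f - g \<in> mrb_ideal \<X> wt"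
  using mrb_ideal_add[of f \<X> wt "scale (- 1) g"] mrb_ideal_scale[of g \<X> wt "- 1"] by simp

lemma linear_in_mrb_ideal:
  fixes T :: "('x, 'k::comm_ring_1) wpoly \<Rightarrow> ('y, 'k) wpoly"
  assumes "linear_op T" "\<And>w. w \<in> Poly_Mapping.keys f \<Longrightarrow> T (wmono w) \<in> mrb_ideal \<X> wt"
  shows "T f \<in> mrb_ideal \<X> wt"
proof -
  have sum: "sum h B \<in> mrb_ideal \<X> wt" if "\<And>b. b \<in> B \<Longrightarrow> h b \<in> mrb_ideal \<X> wt"
    for B and h :: "'x bword \<Rightarrow> ('y, 'k) wpoly"
    using that by (induction B rule: infinite_finite_induct) (auto intro: mrb_ideal_zero mrb_ideal_add)
  show ?thesis
    unfolding linear_op_expand[OF assms(1), of f] by (intro sum mrb_ideal_scale assms(2))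
qed

text \<open>Modulo the ideal the bracket obeys the recursion of the operator: the relation for
  \<open>x\<close> and \<open>y\<close> expresses \<lfloor>x\<lfloor>y\<rfloor>\<rfloor> by terms in
  which \<lfloor>x\<rfloor> may be replaced by P(x), and the remaining outer bracket falls under the
  hypothesis for the nested calls.\<close>

lemma bracket_cong_mrb_op: "w \<in> words \<X> \<Longrightarrow> wmono \<lfloor>\<lfloor>w\<rfloor>\<rfloor> - mrb_op wt w \<in> mrb_ideal \<X> wt"
proof (induction w rule: mrb_op_induct[where wt = wt])
  case (plain w)
  then show ?case by (simp add: mrb_op_plain mrb_ideal_zero)
next
  case (snoc x y)
  then have words: "x \<in> words \<X>" "y \<in> words \<X>" by auto
  let ?d = "wmono \<lfloor>\<lfloor>x\<rfloor>\<rfloor> - mrb_op wt x" and ?g = "mrb_op wt x \<bullet> wmono y"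
  have d: "?d \<in> mrb_ideal \<X> wt" using snoc words by simp
  have "wpoly_bracket ?g - mrb_lin wt ?g \<in> mrb_ideal \<X> wt"
  proof (rule linear_in_mrb_ideal[OF linear_op_diff[OF linear_bracket linear_lin]])
    fix w assume "w \<in> Poly_Mapping.keys ?g"
    then obtain t where t: "t \<in> Poly_Mapping.keys (mrb_op wt x)" "w = t \<cdot> y"
      by (auto dest!: keys_wpoly_mult split: if_splits)
    then have "t \<in> words \<X>"
      using keys_mrb_op[OF t(1)] words by (simp add: words_def)
    then show "wpoly_bracket (wmono w) - mrb_lin wt (wmono w) \<in> mrb_ideal \<X> wt"
      using snoc.IH(2)[OF t(1)] t(2) words by simp
  qed
  moreover have "?d \<bullet> wmono \<lfloor>\<lfloor>y\<rfloor>\<rfloor> \<in> mrb_ideal \<X> wt" "?d \<bullet> wmono y \<in> mrb_ideal \<X> wt"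
    by (rule mrb_ideal_mult_right[OF d]; use words in \<open>simp add: wpolys_wmono\<close>)+
  ultimately have "mrb_rel wt (wmono x) (wmono y) + ?d \<bullet> wmono \<lfloor>\<lfloor>y\<rfloor>\<rfloor> - wpoly_bracket (?d \<bullet> wmono y) -
      (wpoly_bracket ?g - mrb_lin wt ?g) \<in> mrb_ideal \<X> wt"
    by (intro mrb_ideal_diff[OF mrb_ideal_diff[OF mrb_ideal_add[OF mrb_rel_in_mrb_ideal[OF words]]
          mrb_ideal_bracket]])
  also have "mrb_rel wt (wmono x) (wmono y) + ?d \<bullet> wmono \<lfloor>\<lfloor>y\<rfloor>\<rfloor> - wpoly_bracket (?d \<bullet> wmono y) -
      (wpoly_bracket ?g - mrb_lin wt ?g) = wmono \<lfloor>\<lfloor>x \<cdot> \<lfloor>\<lfloor>y\<rfloor>\<rfloor>\<rfloor>\<rfloor> - mrb_op wt (x \<cdot> \<lfloor>\<lfloor>y\<rfloor>\<rfloor>)"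
    by (simp add: mrb_rel_wmono mrb_op_snoc wpoly_mult_diff_left module_hom.diff[OF linear_bracket]
        del: concat_word.simps)
  finally show ?case .
qed

lemma nf_in_wpolys: "w \<in> words \<X> \<Longrightarrow> nf wt w \<in> wpolys \<X>"
  using keys_nf[of _ wt w] by (auto simp: wpolys_def words_def)

lemma wmono_cong_nf: "w \<in> words \<X> \<Longrightarrow> wmono w - nf wt w \<in> mrb_ideal \<X> wt"
proof (induction w rule: bword.induct[where ?P2.0 =
      "\<lambda>p. Single p \<in> words \<X> \<longrightarrow> wmono (Single p) - nf_prime wt p \<in> mrb_ideal \<X> wt"])
  case (Join p w)
  then have words: "Single p \<in> words \<X>" "w \<in> words \<X>" by (auto simp: words_def)
  have "wmono (Join p w) - nf wt (Join p w) =
      (wmono (Single p) - nf_prime wt p) \<bullet> wmono w + nf_prime wt p \<bullet> (wmono w - nf wt w)"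
    by (simp add: wpoly_mult_linear)
  also have "\<dots> \<in> mrb_ideal \<X> wt"
    using mrb_ideal_add[OF mrb_ideal_mult_right[OF Join.hyps[rule_format, OF words(1)]
          wpolys_wmono[OF words(2)]] mrb_ideal_mult_left[OF Join.IH[OF words(2)]]]
      nf_in_wpolys[OF words(1), of wt] by simp
  finally show ?case .
next
  case (Bracket w)
  show ?case
  proof
    assume "\<lfloor>\<lfloor>w\<rfloor>\<rfloor> \<in> words \<X>"
    then have w: "w \<in> words \<X>" by simp
    have "wpoly_bracket (nf wt w) - mrb_lin wt (nf wt w) \<in> mrb_ideal \<X> wt"
    proof (rule linear_in_mrb_ideal[OF linear_op_diff[OF linear_bracket linear_lin]])
      fix t assume "t \<in> Poly_Mapping.keys (nf wt w)"
      then have "t \<in> words \<X>" using nf_in_wpolys[OF w, of wt] by (auto simp: wpolys_def)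
      then show "wpoly_bracket (wmono t) - mrb_lin wt (wmono t) \<in> mrb_ideal \<X> wt"
        by (simp add: bracket_cong_mrb_op)
    qed
    \<comment> \<open>The content of the bracket is replaced by its normal form, and then the
      bracket by the operator.\<close>
    then have "wpoly_bracket (wmono w - nf wt w) + (wpoly_bracket (nf wt w) - mrb_lin wt (nf wt w))
        \<in> mrb_ideal \<X> wt"
      using mrb_ideal_add[OF mrb_ideal_bracket[OF Bracket[OF w]]] by blast
    then show "wmono \<lfloor>\<lfloor>w\<rfloor>\<rfloor> - nf_prime wt (Bracket w) \<in> mrb_ideal \<X> wt"
      by (simp add: module_hom.diff[OF linear_bracket])
  qed
qed (auto simp: mrb_ideal_zero)

lemma cong_normal_form:
  assumes "f \<in> wpolys \<X>" shows "f - normal_form wt f \<in> mrb_ideal \<X> wt"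
proof (rule linear_in_mrb_ideal[OF linear_op_diff[OF linear_op_id linear_lin]])
  fix w assume "w \<in> Poly_Mapping.keys f"
  then have "w \<in> words \<X>" using assms by (auto simp: wpolys_def)
  then show "wmono w - normal_form wt (wmono w) \<in> mrb_ideal \<X> wt" by (simp add: wmono_cong_nf)
qed

lemma normal_form_in_wpolys: "f \<in> wpolys \<X> \<Longrightarrow> normal_form wt f \<in> wpolys \<X>"
  using keys_lin[of "nf wt" f] nf_in_wpolys[of _ \<X> wt] by (fastforce simp: wpolys_def)

text \<open>The kernel of \<open>normal_form\<close> within the carrier is an operated ideal, and it
  contains the relations.\<close>

lemma normal_form_mrb_ideal: "f \<in> mrb_ideal \<X> wt \<Longrightarrow> normal_form wt f = 0"
proof -
  have "operated_ideal (word_algebra \<X>) {f \<in> wpolys \<X>. normal_form wt f = 0}"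
    unfolding operated_ideal_word_algebra_iff
    by (auto intro: wpolys_intros simp: normal_form_mult normal_form_bracket)
  then have "mrb_ideal \<X> wt \<subseteq> {f \<in> wpolys \<X>. normal_form wt f = 0}"
    by (rule mrb_ideal_minimal) (auto simp: S_mrbr_eq normal_form_mrb_defect mrb_rel_in_wpolys)
  then show "f \<in> mrb_ideal \<X> wt \<Longrightarrow> normal_form wt f = 0" by auto
qed

section \<open>The quotient\<close>

definition wpoly_class :: "'x set \<Rightarrow> 'k::comm_ring_1 \<Rightarrow> ('x, 'k) wpoly \<Rightarrow> ('x, 'k) wpoly set"
  where "wpoly_class \<X> wt f = mrb_ideal \<X> wt +>\<^bsub>word_algebra \<X> :: ('k, ('x, 'k) wpoly) operated\<^esub> f"

lemma word_class_eq: "word_class \<X> wt w = wpoly_class \<X> wt (wmono w)"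
  by (simp add: word_class_def wpoly_class_def)

text \<open>Addition in the algebra is that of the type, so no membership in the carrier is
  required.\<close>

lemma mem_wpoly_class: "h \<in> wpoly_class \<X> wt f \<longleftrightarrow> h - f \<in> mrb_ideal \<X> wt"
proof
  assume "h - f \<in> mrb_ideal \<X> wt"
  then show "h \<in> wpoly_class \<X> wt f"
    unfolding wpoly_class_def a_r_coset_def' by (rule UN_I) simp
qed (auto simp: wpoly_class_def a_r_coset_def')

lemma self_in_wpoly_class: "f \<in> wpoly_class \<X> wt f"
  by (simp add: mem_wpoly_class mrb_ideal_zero)

lemma wpoly_class_eq_iff: "wpoly_class \<X> wt f = wpoly_class \<X> wt g \<longleftrightarrow> f - g \<in> mrb_ideal \<X> wt"
proof
  assume "wpoly_class \<X> wt f = wpoly_class \<X> wt g"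
  then show "f - g \<in> mrb_ideal \<X> wt"
    using self_in_wpoly_class[of f \<X> wt] by (simp add: mem_wpoly_class)
next
  assume fg: "f - g \<in> mrb_ideal \<X> wt"
  have "h - f \<in> mrb_ideal \<X> wt \<longleftrightarrow> h - g \<in> mrb_ideal \<X> wt" for h
    using mrb_ideal_add[OF _ fg, of "h - f"] mrb_ideal_diff[OF _ fg, of "h - g"] by auto
  then show "wpoly_class \<X> wt f = wpoly_class \<X> wt g"
    by (auto simp: mem_wpoly_class)
qed

lemma wpoly_class_in_wpolys: "h \<in> wpoly_class \<X> wt f \<Longrightarrow> f \<in> wpolys \<X> \<Longrightarrow> h \<in> wpolys \<X>"
  using wpolys_add[of "h - f" \<X> f] mrb_ideal_subset[of "h - f" \<X> wt] by (simp add: mem_wpoly_class)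

text \<open>Operations of the quotient are unions of classes over all representatives; such a union
  collapses once the class is independent of the representative.\<close>

lemma UN_const_eq: "a \<in> C \<Longrightarrow> (\<And>b. b \<in> C \<Longrightarrow> F b = D) \<Longrightarrow> (\<Union>b\<in>C. F b) = D"
  by blast

lemma carrier_mrb_quotient: "carrier (mrb_quotient \<X> wt) = wpoly_class \<X> wt ` wpolys \<X>"
  by (auto simp: mrb_quotient_def operated_quotient_def FactRing_def A_RCOSETS_def' wpoly_class_def)

lemma mrb_quotient_cases:
  assumes "C \<in> carrier (mrb_quotient \<X> wt)"
  obtains f where "f \<in> wpolys \<X>" "C = wpoly_class \<X> wt f"
  using assms by (auto simp: carrier_mrb_quotient)

lemma wpoly_class_closed: "f \<in> wpolys \<X> \<Longrightarrow> wpoly_class \<X> wt f \<in> carrier (mrb_quotient \<X> wt)"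
  by (simp add: carrier_mrb_quotient)

lemma mrb_quotient_zero: "\<zero>\<^bsub>mrb_quotient \<X> wt\<^esub> = wpoly_class \<X> wt 0"
proof -
  have "\<zero>\<^bsub>mrb_quotient \<X> wt\<^esub> = mrb_ideal \<X> wt"
    by (simp add: mrb_quotient_def operated_quotient_def FactRing_def)
  also have "\<dots> = wpoly_class \<X> wt 0"
    by (rule Set.set_eqI) (simp add: mem_wpoly_class)
  finally show ?thesis .
qed

lemma mrb_quotient_add:
  "wpoly_class \<X> wt f \<oplus>\<^bsub>mrb_quotient \<X> wt\<^esub> wpoly_class \<X> wt g = wpoly_class \<X> wt (f + g)"
proof -
  have "wpoly_class \<X> wt f \<oplus>\<^bsub>mrb_quotient \<X> wt\<^esub> wpoly_class \<X> wt g =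
      (\<Union>a\<in>wpoly_class \<X> wt f. \<Union>b\<in>wpoly_class \<X> wt g. {a + b})"
    by (simp add: mrb_quotient_def operated_quotient_def FactRing_def set_add_def')
  also have "\<dots> = wpoly_class \<X> wt (f + g)"
  proof (intro equalityI subsetI)
    fix h assume "h \<in> wpoly_class \<X> wt (f + g)"
    then have "h - g \<in> wpoly_class \<X> wt f" by (simp add: mem_wpoly_class algebra_simps)
    moreover have "h = (h - g) + g" by simp
    ultimately show "h \<in> (\<Union>a\<in>wpoly_class \<X> wt f. \<Union>b\<in>wpoly_class \<X> wt g. {a + b})"
      using self_in_wpoly_class by blast
  next
    fix h assume "h \<in> (\<Union>a\<in>wpoly_class \<X> wt f. \<Union>b\<in>wpoly_class \<X> wt g. {a + b})"
    then obtain a b where ab: "a - f \<in> mrb_ideal \<X> wt" "b - g \<in> mrb_ideal \<X> wt" "h = a + b"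
      by (auto simp: mem_wpoly_class)
    moreover have "h - (f + g) = (a - f) + (b - g)" using ab(3) by simp
    ultimately show "h \<in> wpoly_class \<X> wt (f + g)"
      unfolding mem_wpoly_class by (metis mrb_ideal_add)
  qed
  finally show ?thesis .
qed

lemma mrb_quotient_mult:
  assumes "f \<in> wpolys \<X>" "g \<in> wpolys \<X>"
  shows "wpoly_class \<X> wt f \<otimes>\<^bsub>mrb_quotient \<X> wt\<^esub> wpoly_class \<X> wt g = wpoly_class \<X> wt (f \<bullet> g)"
proof -
  have "wpoly_class \<X> wt f \<otimes>\<^bsub>mrb_quotient \<X> wt\<^esub> wpoly_class \<X> wt g =
      (\<Union>a\<in>wpoly_class \<X> wt f. \<Union>b\<in>wpoly_class \<X> wt g. wpoly_class \<X> wt (a \<bullet> b))"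
    by (simp add: mrb_quotient_def operated_quotient_def FactRing_def rcoset_mult_def
        wpoly_class_def[of \<X> wt "_ \<bullet> _"])
  also have "\<dots> = wpoly_class \<X> wt (f \<bullet> g)"
  proof (intro UN_const_eq[OF self_in_wpoly_class])
    fix a b assume a: "a \<in> wpoly_class \<X> wt f" and b: "b \<in> wpoly_class \<X> wt g"
    \<comment> \<open>This is ab - fg, split so that each summand has a factor in the ideal.\<close>
    have "(a - f) \<bullet> b + f \<bullet> (b - g) \<in> mrb_ideal \<X> wt"
      using a b assms
      by (intro mrb_ideal_add mrb_ideal_mult_right[of "a - f"] mrb_ideal_mult_left[of "b - g"])
        (simp_all add: mem_wpoly_class wpoly_class_in_wpolys[OF b])
    then show "wpoly_class \<X> wt (a \<bullet> b) = wpoly_class \<X> wt (f \<bullet> g)"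
      by (simp add: wpoly_class_eq_iff wpoly_mult_linear)
  qed
  finally show ?thesis .
qed

lemma mrb_quotient_smult:
  "c \<odot>\<^bsub>mrb_quotient \<X> wt\<^esub> wpoly_class \<X> wt f = wpoly_class \<X> wt (scale c f)"
proof -
  have "c \<odot>\<^bsub>mrb_quotient \<X> wt\<^esub> wpoly_class \<X> wt f =
      (\<Union>a\<in>wpoly_class \<X> wt f. wpoly_class \<X> wt (scale c a))"
    by (simp add: mrb_quotient_def operated_quotient_def wpoly_class_def[of \<X> wt "scale _ _"])
  also have "\<dots> = wpoly_class \<X> wt (scale c f)"
    using mrb_ideal_scale[of "_ - f" \<X> wt c] by (intro UN_const_eq[OF self_in_wpoly_class])
      (simp add: wpoly_class_eq_iff mem_wpoly_class wpoly.scale_right_diff_distrib[symmetric])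
  finally show ?thesis .
qed

lemma mrb_quotient_oper:
  "oper (mrb_quotient \<X> wt) (wpoly_class \<X> wt f) = wpoly_class \<X> wt (wpoly_bracket f)"
proof -
  have "oper (mrb_quotient \<X> wt) (wpoly_class \<X> wt f) =
      (\<Union>a\<in>wpoly_class \<X> wt f. wpoly_class \<X> wt (wpoly_bracket a))"
    by (simp add: mrb_quotient_def operated_quotient_def wpoly_class_def[of \<X> wt "wpoly_bracket _"])
  also have "\<dots> = wpoly_class \<X> wt (wpoly_bracket f)"
    using mrb_ideal_bracket[of "_ - f" \<X> wt] by (intro UN_const_eq[OF self_in_wpoly_class])
      (simp add: wpoly_class_eq_iff mem_wpoly_class module_hom.diff[OF linear_bracket])
  finally show ?thesis .
qed

lemmas mrb_quotient_simps = mrb_quotient_zero mrb_quotient_add mrb_quotient_mult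
  mrb_quotient_smult mrb_quotient_oper

text \<open>The generators involve words only; bilinearity extends the relation to all elements, as
  the axiom for the quotient demands.\<close>

lemma mrb_rel_in_mrb_ideal_wpolys:
  assumes "f \<in> wpolys \<X>" "g \<in> wpolys \<X>"
  shows "mrb_rel wt f g \<in> mrb_ideal \<X> wt"
proof (rule linear_in_mrb_ideal[OF linear_mrb_defect_left[OF linear_bracket]])
  fix x assume x: "x \<in> Poly_Mapping.keys f"
  show "mrb_rel wt (wmono x) g \<in> mrb_ideal \<X> wt"
  proof (rule linear_in_mrb_ideal[OF linear_mrb_defect_right[OF linear_bracket]])
    fix y assume "y \<in> Poly_Mapping.keys g"
    with x show "mrb_rel wt (wmono x) (wmono y) \<in> mrb_ideal \<X> wt"
      using assms by (intro mrb_rel_in_mrb_ideal) (auto simp: wpolys_def)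
  qed
qed

lemma ring_of_type_algebra_simps [simp]:
  "carrier (ring_of_type_algebra :: 'k::comm_ring_1 ring) = UNIV"
  "a \<oplus>\<^bsub>ring_of_type_algebra\<^esub> b = a + (b :: 'k)" "a \<otimes>\<^bsub>ring_of_type_algebra\<^esub> b = a * (b :: 'k)"
  "\<one>\<^bsub>ring_of_type_algebra\<^esub> = (1 :: 'k)" "\<zero>\<^bsub>ring_of_type_algebra\<^esub> = (0 :: 'k)"
  by (simp_all add: ring_of_type_algebra_def)

lemma abelian_group_mrb_quotient: "abelian_group (mrb_quotient \<X> wt)"
proof (rule abelian_groupI)
  fix C D assume "C \<in> carrier (mrb_quotient \<X> wt)" "D \<in> carrier (mrb_quotient \<X> wt)"
  then obtain f g where fg: "f \<in> wpolys \<X>" "C = wpoly_class \<X> wt f"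
    "g \<in> wpolys \<X>" "D = wpoly_class \<X> wt g"
    by (elim mrb_quotient_cases)
  then show "C \<oplus>\<^bsub>mrb_quotient \<X> wt\<^esub> D \<in> carrier (mrb_quotient \<X> wt)"
    by (simp add: mrb_quotient_add wpoly_class_closed wpolys_add)
  from fg show "C \<oplus>\<^bsub>mrb_quotient \<X> wt\<^esub> D = D \<oplus>\<^bsub>mrb_quotient \<X> wt\<^esub> C"
    by (simp add: mrb_quotient_add add.commute)
  fix E assume "E \<in> carrier (mrb_quotient \<X> wt)"
  then obtain h where "h \<in> wpolys \<X>" "E = wpoly_class \<X> wt h"
    by (rule mrb_quotient_cases)
  with fg show "C \<oplus>\<^bsub>mrb_quotient \<X> wt\<^esub> D \<oplus>\<^bsub>mrb_quotient \<X> wt\<^esub> E =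
      C \<oplus>\<^bsub>mrb_quotient \<X> wt\<^esub> (D \<oplus>\<^bsub>mrb_quotient \<X> wt\<^esub> E)"
    by (simp add: mrb_quotient_add add.assoc)
next
  show "\<zero>\<^bsub>mrb_quotient \<X> wt\<^esub> \<in> carrier (mrb_quotient \<X> wt)"
    by (simp add: mrb_quotient_zero wpoly_class_closed wpolys_zero)
next
  fix C assume "C \<in> carrier (mrb_quotient \<X> wt)"
  then obtain f where f: "f \<in> wpolys \<X>" "C = wpoly_class \<X> wt f"
    by (rule mrb_quotient_cases)
  then show "\<zero>\<^bsub>mrb_quotient \<X> wt\<^esub> \<oplus>\<^bsub>mrb_quotient \<X> wt\<^esub> C = C"
    by (simp add: mrb_quotient_add mrb_quotient_zero)
  have "wpoly_class \<X> wt (scale (- 1) f) \<in> carrier (mrb_quotient \<X> wt)"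
    by (rule wpoly_class_closed[OF wpolys_scale[OF f(1)]])
  then show "\<exists>D\<in>carrier (mrb_quotient \<X> wt). D \<oplus>\<^bsub>mrb_quotient \<X> wt\<^esub> C = \<zero>\<^bsub>mrb_quotient \<X> wt\<^esub>"
    by (rule rev_bexI) (simp add: f(2) mrb_quotient_add mrb_quotient_zero)
qed

theorem modified_rota_baxter_algebra_mrb_quotient:
  "modified_rota_baxter_algebra wt (mrb_quotient \<X> wt)"
proof -
  let ?Q = "mrb_quotient \<X> wt"
  have ex: "\<exists>f\<in>wpolys \<X>. C = wpoly_class \<X> wt f" if "C \<in> carrier ?Q" for C
    using that by (rule mrb_quotient_cases) blast
  note simps = mrb_quotient_simps wpolys_intros wpoly_class_closed
  have "Module.module ring_of_type_algebra ?Q"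
  proof (rule Module.moduleI[OF cring_from_type_algebra abelian_group_mrb_quotient], goal_cases)
    case (1 a C)
    with ex[of C] show ?case by (auto simp: simps)
  next
    case (2 a b C)
    with ex[of C] show ?case by (auto simp: simps wpoly.scale_left_distrib)
  next
    case (3 a C D)
    with ex[of C] ex[of D] show ?case by (auto simp: simps wpoly.scale_right_distrib)
  next
    case (4 a b C)
    with ex[of C] show ?case by (auto simp: simps)
  next
    case (5 C)
    with ex[of C] show ?case by (auto simp: simps)
  qed
  then interpret Module.module ring_of_type_algebra ?Q .
  have rota_baxter: "wpoly_class \<X> wt (wpoly_bracket f \<bullet> wpoly_bracket g) = wpoly_class \<X> wt
      (wpoly_bracket (wpoly_bracket f \<bullet> g + f \<bullet> wpoly_bracket g) + scale wt (f \<bullet> g))"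
    if "f \<in> wpolys \<X>" "g \<in> wpolys \<X>" for f g
  proof -
    have "wpoly_bracket f \<bullet> wpoly_bracket g -
        (wpoly_bracket (wpoly_bracket f \<bullet> g + f \<bullet> wpoly_bracket g) + scale wt (f \<bullet> g)) =
        scale (- 1) (mrb_rel wt f g)"
      by (simp add: mrb_defect_def module_hom.add[OF linear_bracket])
    then show ?thesis
      unfolding wpoly_class_eq_iff by (simp only: mrb_ideal_scale mrb_rel_in_mrb_ideal_wpolys that)
  qed
  show ?thesis
  proof (intro modified_rota_baxter_algebra.intro nonunitary_algebra.intro
      nonunitary_algebra_axioms.intro modified_rota_baxter_algebra_axioms.intro module_axioms,
      goal_cases)
    case (1 C D)
    with ex[of C] ex[of D] show ?case by (auto simp: simps)
  next
    case (2 C D E)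
    with ex[of C] ex[of D] ex[of E] show ?case by (auto simp: simps wpoly_mult_assoc)
  next
    case (3 C D E)
    with ex[of C] ex[of D] ex[of E] show ?case by (auto simp: simps wpoly_mult_linear)
  next
    case (4 C D E)
    with ex[of C] ex[of D] ex[of E] show ?case by (auto simp: simps wpoly_mult_linear)
  next
    case (5 C D c)
    with ex[of C] ex[of D] show ?case by (auto simp: simps wpoly_mult_linear)
  next
    case (6 C D c)
    with ex[of C] ex[of D] show ?case by (auto simp: simps wpoly_mult_linear)
  next
    case (7 C)
    with ex[of C] show ?case by (auto simp: simps)
  next
    case (8 C D)
    with ex[of C] ex[of D] show ?case by (auto simp: simps module_hom.add[OF linear_bracket])
  next
    case (9 C c)
    with ex[of C] show ?case by (auto simp: simps module_hom.scale[OF linear_bracket])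
  next
    case (10 C D)
    with ex[of C] ex[of D] show ?case by (auto simp: simps rota_baxter)
  qed
qed

section \<open>The universal property\<close>

primrec word_eval :: "('k, 'b, 'm) operated_scheme \<Rightarrow> ('x \<Rightarrow> 'b) \<Rightarrow> 'x bword \<Rightarrow> 'b"
  and prime_eval :: "('k, 'b, 'm) operated_scheme \<Rightarrow> ('x \<Rightarrow> 'b) \<Rightarrow> 'x prime_word \<Rightarrow> 'b" where
  "word_eval B \<phi> (Single p) = prime_eval B \<phi> p"
| "word_eval B \<phi> (Join p w) = prime_eval B \<phi> p \<otimes>\<^bsub>B\<^esub> word_eval B \<phi> w"
| "prime_eval B \<phi> (Letter x) = \<phi> x"
| "prime_eval B \<phi> (Bracket w) = oper B (word_eval B \<phi> w)"

definition wpoly_eval ::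
  "('k::comm_ring_1, 'b, 'm) operated_scheme \<Rightarrow> ('x \<Rightarrow> 'b) \<Rightarrow> ('x, 'k) wpoly \<Rightarrow> 'b" where
  "wpoly_eval B \<phi> f =
     (\<Oplus>\<^bsub>B\<^esub>w\<in>Poly_Mapping.keys f. Poly_Mapping.lookup f w \<odot>\<^bsub>B\<^esub> word_eval B \<phi> w)"

locale letter_evaluation = modified_rota_baxter_algebra wt B
  for wt :: "'k::comm_ring_1" and B :: "('k, 'b, 'm) operated_scheme" (structure) +
  fixes \<X> :: "'x set" and \<phi> :: "'x \<Rightarrow> 'b"
  assumes letter_closed: "\<phi> \<in> \<X> \<rightarrow> carrier B"
begin

lemma word_eval_closed: "w \<in> words \<X> \<Longrightarrow> word_eval B \<phi> w \<in> carrier B"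
  by (induction w rule: bword.induct[where ?P2.0 =
        "\<lambda>p. Single p \<in> words \<X> \<longrightarrow> prime_eval B \<phi> p \<in> carrier B"])
    (use letter_closed in \<open>auto simp: words_def mult_closed oper_closed\<close>)

lemma word_eval_concat:
  "u \<in> words \<X> \<Longrightarrow> v \<in> words \<X> \<Longrightarrow>
    word_eval B \<phi> (u \<cdot> v) = word_eval B \<phi> u \<otimes> word_eval B \<phi> v"
proof (induction u rule: bword.induct[where ?P2.0 = "\<lambda>_. True"])
  case (Join p u)
  then have "Single p \<in> words \<X>" "u \<in> words \<X>" by (auto simp: words_def)
  then show ?case
    using Join word_eval_closed[of "Single p"] by (simp add: mult_assoc word_eval_closed)
qed auto

text \<open>Polynomials with different supports can thereby be evaluated over a common index
  set.\<close>

lemma wpoly_eval_superset: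
  assumes "finite V" "Poly_Mapping.keys f \<subseteq> V" "V \<subseteq> words \<X>"
  shows "wpoly_eval B \<phi> f = (\<Oplus>w\<in>V. Poly_Mapping.lookup f w \<odot> word_eval B \<phi> w)"
  unfolding wpoly_eval_def
proof (rule M.add.finprod_mono_neutral_cong_left)
  fix w assume "w \<in> V - Poly_Mapping.keys f"
  then show "Poly_Mapping.lookup f w \<odot> word_eval B \<phi> w = \<zero>"
    using assms(3) smult_l_null[OF word_eval_closed, of w] by (auto simp: in_keys_iff)
qed (use assms word_eval_closed in auto)

lemma wpoly_eval_closed: "f \<in> wpolys \<X> \<Longrightarrow> wpoly_eval B \<phi> f \<in> carrier B"
  unfolding wpoly_eval_def wpolys_def using word_eval_closed by (intro M.finsum_closed) auto

lemma wpoly_eval_add: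
  assumes "f \<in> wpolys \<X>" "g \<in> wpolys \<X>"
  shows "wpoly_eval B \<phi> (f + g) = wpoly_eval B \<phi> f \<oplus> wpoly_eval B \<phi> g"
proof -
  let ?V = "Poly_Mapping.keys f \<union> Poly_Mapping.keys g"
  have V: "finite ?V" "?V \<subseteq> words \<X>" "Poly_Mapping.keys (f + g) \<subseteq> ?V"
    using assms keys_add[of f g] by (auto simp: wpolys_def)
  have closed: "word_eval B \<phi> w \<in> carrier B" if "w \<in> ?V" for w
    using V that word_eval_closed by blast
  have "wpoly_eval B \<phi> (f + g) = (\<Oplus>w\<in>?V. Poly_Mapping.lookup (f + g) w \<odot> word_eval B \<phi> w)"
    by (rule wpoly_eval_superset) (use V in auto)
  also have "\<dots> = (\<Oplus>w\<in>?V. Poly_Mapping.lookup f w \<odot> word_eval B \<phi> w \<oplus>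
      Poly_Mapping.lookup g w \<odot> word_eval B \<phi> w)"
    using closed smult_l_distr by (intro M.finsum_cong') (auto simp: lookup_add)
  also have "\<dots> = (\<Oplus>w\<in>?V. Poly_Mapping.lookup f w \<odot> word_eval B \<phi> w) \<oplus>
      (\<Oplus>w\<in>?V. Poly_Mapping.lookup g w \<odot> word_eval B \<phi> w)"
    using closed by (intro M.finsum_addf) auto
  also have "\<dots> = wpoly_eval B \<phi> f \<oplus> wpoly_eval B \<phi> g"
    using V by (simp add: wpoly_eval_superset[of ?V])
  finally show ?thesis .
qed

lemma wpoly_eval_scale:
  assumes "f \<in> wpolys \<X>"
  shows "wpoly_eval B \<phi> (scale c f) = c \<odot> wpoly_eval B \<phi> f"
proof -
  have closed: "word_eval B \<phi> w \<in> carrier B" if "w \<in> Poly_Mapping.keys f" for w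
    using that assms word_eval_closed by (auto simp: wpolys_def)
  have "wpoly_eval B \<phi> (scale c f) =
      (\<Oplus>w\<in>Poly_Mapping.keys f. Poly_Mapping.lookup (scale c f) w \<odot> word_eval B \<phi> w)"
    using assms keys_scale[of c f] by (intro wpoly_eval_superset) (auto simp: wpolys_def)
  also have "\<dots> = (\<Oplus>w\<in>Poly_Mapping.keys f. c \<odot> (Poly_Mapping.lookup f w \<odot> word_eval B \<phi> w))"
    using closed smult_assoc1 by (intro M.finsum_cong') auto
  also have "\<dots> = c \<odot> wpoly_eval B \<phi> f"
    unfolding wpoly_eval_def using closed by (intro finsum_smult_ldistr[symmetric]) auto
  finally show ?thesis .
qed

lemma wpoly_eval_zero: "wpoly_eval B \<phi> 0 = \<zero>"
  by (simp add: wpoly_eval_def)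

lemma wpoly_eval_wmono: "w \<in> words \<X> \<Longrightarrow> wpoly_eval B \<phi> (wmono w) = word_eval B \<phi> w"
  using wpoly_eval_superset[of "{w}" "wmono w"] word_eval_closed[of w]
    smult_one[OF word_eval_closed, of w] by simp

text \<open>The axioms give homogeneity, so here and in the next two lemmas zero is treated as a
  multiple by the scalar 0.\<close>

lemma oper_zero: "oper B \<zero> = \<zero>"
  using oper_smult[of \<zero> 0] smult_l_null oper_closed by fastforce

lemma mult_zero_left: "x \<in> carrier B \<Longrightarrow> \<zero> \<otimes> x = \<zero>"
  using smult_mult_left[of \<zero> x 0] smult_l_null mult_closed by fastforce

lemma mult_zero_right: "x \<in> carrier B \<Longrightarrow> x \<otimes> \<zero> = \<zero>"
  using smult_mult_right[of x \<zero> 0] smult_l_null mult_closed by fastforce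

lemma wpoly_eval_bracket:
  assumes "f \<in> wpolys \<X>"
  shows "wpoly_eval B \<phi> (wpoly_bracket f) = oper B (wpoly_eval B \<phi> f)"
  using assms
proof (induction f rule: wpolys_induct)
  case zero
  then show ?case by (simp add: wpoly_eval_zero oper_zero module_hom.zero[OF linear_bracket])
next
  case (monomial c w g)
  then show ?case
    by (simp add: module_hom.add[OF linear_bracket] module_hom.scale[OF linear_bracket]
        wpoly_eval_add wpoly_eval_scale wpoly_eval_wmono wpolys_intros oper_add oper_smult
        word_eval_closed wpoly_eval_closed del: scale_single)
qed

lemma wpoly_eval_mult:
  assumes "f \<in> wpolys \<X>" "g \<in> wpolys \<X>"
  shows "wpoly_eval B \<phi> (f \<bullet> g) = wpoly_eval B \<phi> f \<otimes> wpoly_eval B \<phi> g"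
proof -
  have mono: "wpoly_eval B \<phi> (wmono u \<bullet> g) = word_eval B \<phi> u \<otimes> wpoly_eval B \<phi> g"
    if "u \<in> words \<X>" for u
    using assms(2)
  proof (induction g rule: wpolys_induct)
    case zero
    then show ?case using that by (simp add: wpoly_eval_zero mult_zero_right word_eval_closed)
  next
    case (monomial c w g)
    then show ?case
      using that
      by (simp add: wpoly_mult_linear wpoly_eval_add wpoly_eval_scale wpoly_eval_wmono wpolys_intros
          mult_distrib_left smult_mult_right word_eval_concat word_eval_closed wpoly_eval_closed
          del: scale_single)
  qed
  show ?thesis
    using assms(1)
  proof (induction f rule: wpolys_induct)
    case zero
    then show ?case using assms by (simp add: wpoly_eval_zero mult_zero_left wpoly_eval_closed)
  next
    case (monomial c w f)
    then show ?case
      using assms(2)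
      by (simp add: wpoly_mult_linear wpoly_eval_add wpoly_eval_scale wpoly_eval_wmono wpolys_intros
          mult_distrib_right smult_mult_left mono word_eval_closed wpoly_eval_closed
          del: scale_single)
  qed
qed

text \<open>Adding back the subtracted product \<lfloor>x\<rfloor>\<lfloor>y\<rfloor> leaves only
  sums, whose evaluation is the axiom of the target algebra; cancellation in its additive group then
  replaces subtraction.\<close>

lemma wpoly_eval_mrb_rel:
  assumes "x \<in> words \<X>" "y \<in> words \<X>"
  shows "wpoly_eval B \<phi> (mrb_rel wt (wmono x) (wmono y)) = \<zero>"
proof -
  let ?R = "mrb_rel wt (wmono x) (wmono y) :: ('x, 'k) wpoly"
  let ?x = "word_eval B \<phi> x" and ?y = "word_eval B \<phi> y"
  let ?p = "wpoly_bracket (wmono x) \<bullet> wpoly_bracket (wmono y) :: ('x, 'k) wpoly"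
  note closed = word_eval_closed[OF assms(1)] word_eval_closed[OF assms(2)]
  note intros = wpolys_wmono[OF assms(1)] wpolys_wmono[OF assms(2)] wpolys_intros(1-4,7)
  have p: "wpoly_eval B \<phi> ?p = oper B ?x \<otimes> oper B ?y"
    using assms by (simp add: wpoly_eval_mult wpoly_eval_bracket wpoly_eval_wmono wpolys_intros
        del: wpoly_bracket_wmono)
  have "wpoly_eval B \<phi> ?R \<oplus> wpoly_eval B \<phi> ?p = wpoly_eval B \<phi> (?R + ?p)"
    using assms by (intro wpoly_eval_add[symmetric] mrb_rel_in_wpolys intros)
  also have "?R + ?p = wpoly_bracket (wmono x \<bullet> wpoly_bracket (wmono y)) +
      wpoly_bracket (wpoly_bracket (wmono x) \<bullet> wmono y) + scale wt (wmono x \<bullet> wmono y)"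
    by (simp add: mrb_defect_def)
  also have "wpoly_eval B \<phi> \<dots> = oper B (?x \<otimes> oper B ?y) \<oplus> oper B (oper B ?x \<otimes> ?y) \<oplus> wt \<odot> (?x \<otimes> ?y)"
    using assms by (simp add: wpoly_eval_add wpoly_eval_mult wpoly_eval_bracket wpoly_eval_scale
        wpoly_eval_wmono wpolys_intros del: wpoly_bracket_wmono wmono_mult_wmono scale_single)
  also have "\<dots> = wpoly_eval B \<phi> ?p"
    unfolding p using closed
    by (simp add: modified_rota_baxter oper_add mult_closed oper_closed M.a_comm)
  finally have "wpoly_eval B \<phi> ?R \<oplus> wpoly_eval B \<phi> ?p = wpoly_eval B \<phi> ?p" .
  then show ?thesis
    using wpoly_eval_closed[OF mrb_rel_in_wpolys[OF assms]] closed p mult_closed oper_closed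
    by (metis M.add.r_cancel M.l_zero M.zero_closed)
qed

lemma wpoly_eval_mrb_ideal:
  assumes "f \<in> mrb_ideal \<X> wt" shows "wpoly_eval B \<phi> f = \<zero>"
proof -
  have "operated_ideal (word_algebra \<X>) {f \<in> wpolys \<X>. wpoly_eval B \<phi> f = \<zero>}"
    unfolding operated_ideal_word_algebra_iff
    by (auto intro: wpolys_intros simp: wpoly_eval_zero wpoly_eval_add wpoly_eval_scale
        wpoly_eval_mult wpoly_eval_bracket oper_zero mult_zero_left mult_zero_right wpoly_eval_closed)
  then have "mrb_ideal \<X> wt \<subseteq> {f \<in> wpolys \<X>. wpoly_eval B \<phi> f = \<zero>}"
    by (rule mrb_ideal_minimal) (auto simp: S_mrbr_eq wpoly_eval_mrb_rel mrb_rel_in_wpolys)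
  with assms show ?thesis by auto
qed

text \<open>An arbitrary representative is chosen; evaluation kills the ideal, so the choice does
  not affect the value.\<close>

definition class_eval :: "('x, 'k) wpoly set \<Rightarrow> 'b"
  where "class_eval C = wpoly_eval B \<phi> (SOME f. f \<in> C)"

lemma class_eval_wpoly_class:
  assumes "f \<in> wpolys \<X>"
  shows "class_eval (wpoly_class \<X> wt f) = wpoly_eval B \<phi> f"
proof -
  define h where "h = (SOME h. h \<in> wpoly_class \<X> wt f)"
  have "h - f \<in> mrb_ideal \<X> wt"
    using someI[of "\<lambda>h. h \<in> wpoly_class \<X> wt f", OF self_in_wpoly_class]
    by (simp add: h_def mem_wpoly_class)
  then have "wpoly_eval B \<phi> ((h - f) + f) = wpoly_eval B \<phi> f"
    using assms wpoly_eval_closed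
    by (subst wpoly_eval_add) (auto simp: wpoly_eval_mrb_ideal mrb_ideal_subset)
  then show ?thesis by (simp add: class_eval_def h_def)
qed

lemma class_eval_hom: "class_eval \<in> operated_hom (mrb_quotient \<X> wt) B"
  by (auto simp: operated_hom_def carrier_mrb_quotient mrb_quotient_simps class_eval_wpoly_class
      wpolys_intros wpoly_eval_closed wpoly_eval_add wpoly_eval_mult wpoly_eval_scale
      wpoly_eval_bracket)

lemma hom_unique:
  assumes G: "G \<in> operated_hom (mrb_quotient \<X> wt) B"
    and letters: "\<And>x. x \<in> \<X> \<Longrightarrow> G (word_class \<X> wt (letter x)) = \<phi> x"
    and f: "f \<in> wpolys \<X>"
  shows "G (wpoly_class \<X> wt f) = wpoly_eval B \<phi> f"
proof -
  let ?c = "wpoly_class \<X> wt"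
  have add: "G (?c (f + g)) = G (?c f) \<oplus> G (?c g)"
    and mult: "G (?c (f \<bullet> g)) = G (?c f) \<otimes> G (?c g)"
    if "f \<in> wpolys \<X>" "g \<in> wpolys \<X>" for f g
    using G that by (auto simp: operated_hom_def wpoly_class_closed mrb_quotient_simps[symmetric])
  have scale: "G (?c (scale c f)) = c \<odot> G (?c f)"
    and bracket: "G (?c (wpoly_bracket f)) = oper B (G (?c f))"
    and closed: "G (?c f) \<in> carrier B"
    if "f \<in> wpolys \<X>" for f c
    using G that by (auto simp: operated_hom_def wpoly_class_closed mrb_quotient_simps[symmetric])
  have word: "G (?c (wmono w)) = word_eval B \<phi> w" if "w \<in> words \<X>" for w
    using that
  proof (induction w rule: bword.induct[where ?P2.0 =
        "\<lambda>p. Single p \<in> words \<X> \<longrightarrow> G (?c (wmono (Single p))) = prime_eval B \<phi> p"])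
    case (Join p w)
    then have words: "Single p \<in> words \<X>" "w \<in> words \<X>" by (auto simp: words_def)
    then show ?case
      using Join mult[OF wpolys_wmono[OF words(1)] wpolys_wmono[OF words(2)]] by simp
  next
    case (Bracket w)
    then show ?case using bracket[OF wpolys_wmono, of w] by simp
  next
    case (Letter x)
    then show ?case using letters by (simp add: word_class_eq)
  qed simp
  show ?thesis
    using f
  proof (induction f rule: wpolys_induct)
    case zero
    \<comment> \<open>Homogeneity with the scalar 0 forces \<open>G\<close> to preserve
      zero.\<close>
    have "G (?c (scale 0 0)) = 0 \<odot> G (?c 0)" by (rule scale[OF wpolys_zero])
    then show ?case
      using smult_l_null[OF closed[OF wpolys_zero]] by (simp add: wpoly_eval_zero)
  next
    case (monomial c w g)
    then show ?case
      by (simp add: add scale word wpolys_intros wpoly_eval_add wpoly_eval_scale wpoly_eval_wmono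
          del: scale_single)
  qed
qed

end

theorem free_modified_rota_baxter_algebra_mrb_quotient:
  fixes \<X> :: "'x set" and wt :: "'k::comm_ring_1"
  shows "free_modified_rota_baxter_algebra TYPE('b) wt \<X> (\<lambda>x. word_class \<X> wt (letter x))
     (mrb_quotient \<X> wt)"
  unfolding free_modified_rota_baxter_algebra_def
proof (intro conjI allI impI)
  show "modified_rota_baxter_algebra wt (mrb_quotient \<X> wt)"
    by (rule modified_rota_baxter_algebra_mrb_quotient)
  show "(\<lambda>x. word_class \<X> wt (letter x)) \<in> \<X> \<rightarrow> carrier (mrb_quotient \<X> wt)"
    by (auto simp: word_class_eq wpoly_class_closed wpolys_wmono)
next
  fix B :: "('k, 'b) operated" and \<phi>
  assume "modified_rota_baxter_algebra wt B \<and> \<phi> \<in> \<X> \<rightarrow> carrier B"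
  then interpret letter_evaluation wt B \<X> \<phi>
    by (simp add: letter_evaluation_def letter_evaluation_axioms_def)
  show "\<exists>F\<in>operated_hom (mrb_quotient \<X> wt) B. (\<forall>x\<in>\<X>. F (word_class \<X> wt (letter x)) = \<phi> x) \<and>
         (\<forall>G\<in>operated_hom (mrb_quotient \<X> wt) B. (\<forall>x\<in>\<X>. G (word_class \<X> wt (letter x)) = \<phi> x) \<longrightarrow>
           (\<forall>a\<in>carrier (mrb_quotient \<X> wt). G a = F a))"
    by (intro bexI[OF _ class_eval_hom])
      (auto simp: word_class_eq class_eval_wpoly_class wpolys_wmono wpoly_eval_wmono
        carrier_mrb_quotient hom_unique)
qed

section \<open>The basis of irreducible words\<close>

lemma irr_normal_form: "w \<in> Poly_Mapping.keys (normal_form wt f) \<Longrightarrow> irr w"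
  by (auto dest!: subsetD[OF keys_lin] keys_nf)

text \<open>A basis given as a set of classes would not reveal whether two irreducible words share a
  class. They do not, because the normal form fixes their difference and annihilates the
  ideal.\<close>

lemma inj_on_word_class: "inj_on (word_class \<X> wt) (Irr_mrbr \<X>)"
proof (rule inj_onI)
  fix u v assume "u \<in> Irr_mrbr \<X>" "v \<in> Irr_mrbr \<X>" "word_class \<X> wt u = word_class \<X> wt v"
  then have "wmono u - wmono v \<in> mrb_ideal \<X> wt" "irr u" "irr v"
    by (auto simp: word_class_eq wpoly_class_eq_iff Irr_mrbr_eq)
  then have "(wmono u :: ('a, 'b) wpoly) = wmono v"
    using normal_form_mrb_ideal[of "wmono u - wmono v" \<X> wt] by (simp add: nf_irr)
  then show "u = v" by (metis keys_single singleton_inject zero_neq_one)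
qed

lemma finsum_wpoly_class:
  assumes "finite V" "\<And>v. v \<in> V \<Longrightarrow> h v \<in> wpolys \<X>"
  shows "(\<Oplus>\<^bsub>mrb_quotient \<X> wt\<^esub>v\<in>V. wpoly_class \<X> wt (h v)) = wpoly_class \<X> wt (\<Sum>v\<in>V. h v)"
proof -
  interpret abelian_group "mrb_quotient \<X> wt" by (rule abelian_group_mrb_quotient)
  show ?thesis
    using assms
    by (induction V rule: finite_induct)
      (auto simp: mrb_quotient_zero mrb_quotient_add wpoly_class_closed Pi_def)
qed

text \<open>Coefficients in \<open>module_basis\<close> are indexed by classes; injectivity permits
  reindexing by words and turns the combination into the class of one polynomial.\<close>

lemma finsum_word_class:
  assumes "finite V" "V \<subseteq> Irr_mrbr \<X>"
  shows "(\<Oplus>\<^bsub>mrb_quotient \<X> wt\<^esub>b\<in>word_class \<X> wt ` V. c b \<odot>\<^bsub>mrb_quotient \<X> wt\<^esub> b) =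
    wpoly_class \<X> wt (\<Sum>w\<in>V. scale (c (word_class \<X> wt w)) (wmono w))"
proof -
  interpret abelian_group "mrb_quotient \<X> wt" by (rule abelian_group_mrb_quotient)
  have words: "w \<in> words \<X>" if "w \<in> V" for w
    using that assms(2) by (auto simp: Irr_mrbr_eq)
  have "(\<Oplus>\<^bsub>mrb_quotient \<X> wt\<^esub>b\<in>word_class \<X> wt ` V. c b \<odot>\<^bsub>mrb_quotient \<X> wt\<^esub> b) =
      (\<Oplus>\<^bsub>mrb_quotient \<X> wt\<^esub>w\<in>V. c (word_class \<X> wt w) \<odot>\<^bsub>mrb_quotient \<X> wt\<^esub> word_class \<X> wt w)"
    using inj_on_subset[OF inj_on_word_class assms(2)] words
    by (intro finsum_reindex) (auto simp: word_class_eq mrb_quotient_smult wpoly_class_closed wpolys_intros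
        simp del: scale_single)
  also have "\<dots> = (\<Oplus>\<^bsub>mrb_quotient \<X> wt\<^esub>w\<in>V. wpoly_class \<X> wt (scale (c (word_class \<X> wt w)) (wmono w)))"
    by (simp add: word_class_eq mrb_quotient_smult)
  also have "\<dots> = wpoly_class \<X> wt (\<Sum>w\<in>V. scale (c (word_class \<X> wt w)) (wmono w))"
    using assms(1) words by (intro finsum_wpoly_class) (auto intro!: wpolys_intros simp del: scale_single)
  finally show ?thesis .
qed

theorem module_basis_mrb_quotient: "module_basis (mrb_quotient \<X> wt) (word_class \<X> wt ` Irr_mrbr \<X>)"
  unfolding module_basis_def
proof (intro conjI ballI allI impI)
  show "word_class \<X> wt ` Irr_mrbr \<X> \<subseteq> carrier (mrb_quotient \<X> wt)"
    by (auto simp: Irr_mrbr_eq word_class_eq wpoly_class_closed wpolys_wmono)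
next
  fix C assume "C \<in> carrier (mrb_quotient \<X> wt)"
  then obtain f where f: "f \<in> wpolys \<X>" "C = wpoly_class \<X> wt f"
    by (auto simp: carrier_mrb_quotient)
  let ?n = "normal_form wt f"
  \<comment> \<open>The coefficient of a class is read off at its unique irreducible word.\<close>
  define c where "c b = Poly_Mapping.lookup ?n (the_inv_into (Irr_mrbr \<X>) (word_class \<X> wt) b)" for b
  have irr: "Poly_Mapping.keys ?n \<subseteq> Irr_mrbr \<X>"
    using normal_form_in_wpolys[OF f(1), of wt]
    by (auto simp: Irr_mrbr_eq wpolys_def irr_normal_form)
  have "(\<Sum>w\<in>Poly_Mapping.keys ?n. scale (c (word_class \<X> wt w)) (wmono w)) =
      (\<Sum>w\<in>Poly_Mapping.keys ?n. scale (Poly_Mapping.lookup ?n w) (wmono w))"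
    using irr by (intro sum.cong) (auto simp: c_def the_inv_into_f_f[OF inj_on_word_class])
  also have "\<dots> = ?n" by (rule wpoly_expand[symmetric]) auto
  finally have "C = (\<Oplus>\<^bsub>mrb_quotient \<X> wt\<^esub>b\<in>word_class \<X> wt ` Poly_Mapping.keys ?n.
      c b \<odot>\<^bsub>mrb_quotient \<X> wt\<^esub> b)"
    using finsum_word_class[OF finite_keys irr, of wt c] cong_normal_form[OF f(1), of wt]
    by (simp add: f(2) wpoly_class_eq_iff del: scale_single)
  with irr show "\<exists>F c. finite F \<and> F \<subseteq> word_class \<X> wt ` Irr_mrbr \<X> \<and>
      C = (\<Oplus>\<^bsub>mrb_quotient \<X> wt\<^esub>b\<in>F. c b \<odot>\<^bsub>mrb_quotient \<X> wt\<^esub> b)"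
    by (intro exI[of _ "word_class \<X> wt ` Poly_Mapping.keys ?n"] exI[of _ c] conjI)
      (auto simp del: scale_single)
next
  fix F c b
  assume "b \<in> F" and F: "finite F \<and> F \<subseteq> word_class \<X> wt ` Irr_mrbr \<X> \<and>
    (\<Oplus>\<^bsub>mrb_quotient \<X> wt\<^esub>b\<in>F. c b \<odot>\<^bsub>mrb_quotient \<X> wt\<^esub> b) = \<zero>\<^bsub>mrb_quotient \<X> wt\<^esub>"
  then obtain V where V: "V \<subseteq> Irr_mrbr \<X>" "finite V" "F = word_class \<X> wt ` V"
    by (meson finite_subset_image)
  let ?s = "\<Sum>w\<in>V. scale (c (word_class \<X> wt w)) (wmono w)"
  have lookup: "Poly_Mapping.lookup ?s v = (if v \<in> V then c (word_class \<X> wt v) else 0)" for v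
    using V(2) by (simp add: lookup_sum lookup_single when_def sum.delta)
  have "?s \<in> mrb_ideal \<X> wt"
    using F V finsum_word_class[OF V(2,1), of wt c]
    by (simp add: mrb_quotient_zero wpoly_class_eq_iff del: scale_single)
  then have "normal_form wt ?s = 0" by (rule normal_form_mrb_ideal)
  \<comment> \<open>The combination has irreducible support, so the map that annihilates it also
    fixes it.\<close>
  moreover have "normal_form wt ?s = ?s"
    using V(1) lookup by (intro normal_form_irr)
      (auto simp: in_keys_iff Irr_mrbr_eq split: if_splits simp del: scale_single)
  ultimately have "?s = 0" by simp
  then have "c (word_class \<X> wt v) = 0" if "v \<in> V" for v
    using lookup[of v] that by (simp del: scale_single)
  then show "c b = 0" using V(3) \<open>b \<in> F\<close> by blast
qed

theorem theorem4p7: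
  fixes \<X> :: "'x::wellorder set" and wt :: "'k::{comm_ring_1, ring_char_0}"
  shows "groebner_shirshov_basis \<X> PLr_le (S_mrbr \<X> wt) \<and>
    free_modified_rota_baxter_algebra TYPE('b) wt \<X> (\<lambda>x. word_class \<X> wt (letter x))
      (mrb_quotient \<X> wt) \<and>
    inj_on (word_class \<X> wt) (Irr_mrbr \<X>) \<and>
    module_basis (mrb_quotient \<X> wt) (word_class \<X> wt ` Irr_mrbr \<X>)"
  by (intro conjI groebner_shirshov_basis_S_mrbr free_modified_rota_baxter_algebra_mrb_quotient
      inj_on_word_class module_basis_mrb_quotient)

end
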